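(* Let $G=G(z)$ be the Cauchy–Stieltjes transform of a positive random variable $Z$. Suppose that $G$ satisfies, for $z\in\mathbb C\setminus[0,\infty)$, the equation $$z(z+1)G^2(z)-\big(\gamma z(z+1)-(\alpha-1)(z+1)+\beta z\big)G(z)+\gamma z+\delta=0$$ for some $\alpha,\gamma>0$ and $\beta,\delta\in\mathbb R$. If either $\beta\ge0$ or $\alpha>1$, then $\delta$ is uniquely determined by $\alpha,\beta,\gamma$, and $Z$ has the free-Kummer distribution $\mathcal K(\alpha,\beta,\gamma)$.
   Context: A positive random variable $Z$ is a positive element of a $C^*$-probability space $(\mathcal A,\varphi)$ ($\varphi$ a faithful tracial state); its distribution $\mu_Z$ is the compactly supported probability measure on $[0,\infty)$ with moments $\varphi(Z^n)$. Its Cauchy–Stieltjes transform is $G(z)=\int\frac{\mu_Z(dx)}{z-x}$. Free-Kummer distribution $\mathcal K(\alpha,\beta,\gamma)$, $\alpha>0,\beta\in\mathbb R,\gamma>0$: (i) If $\alpha\ne1$, or if $\alpha=1$ and $\beta<1-(1+\sqrt\gamma)^2$, let $(a,b)$ be the unique solution with $0<a<b$ of $$\gamma+\frac{\beta}{\sqrt{(a+1)(b+1)}}-\frac{|\alpha-1|}{\sqrt{ab}}=0,\qquad \gamma\frac{a+b}{2}-\alpha+1+\beta-\frac{\beta}{\sqrt{(a+1)(b+1)}}=2.$$ Then $\mathcal K(\alpha,\beta,\gamma)=\max\{0,1-\alpha\}\delta_0+f(x)\,dx$, where $$f(x)=\frac{1}{2\pi}\sqrt{(x-a)(b-x)}\left(\frac{|\alpha-1|}{x\sqrt{ab}}-\frac{\beta}{(1+x)\sqrt{(a+1)(b+1)}}\right)\mathbf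 1_{(a,b)}(x).$$ (ii) If $\alpha=1$ and $\beta\ge1-(1+\sqrt\gamma)^2$, let $b$ be the unique positive solution of $\gamma\frac b2+\beta-\frac{\beta}{\sqrt{b+1}}=2$ and $\sigma=\gamma+\frac{\beta}{\sqrt{b+1}}$. Then $\mathcal K(1,\beta,\gamma)$ has density $$\frac{1}{2\pi}\sqrt{x(b-x)}\left(\frac{\sigma}{x}-\frac{\beta}{(1+x)\sqrt{b+1}}\right)\mathbf 1_{(0,b)}(x).$$ *)

theory Defs
  imports "HOL-Probability.Probability"
begin

(* Unital C*-algebras.  The library has no complex normed algebras, so the complex scalar
   multiplication extends the real one of the type class; completeness is the class banach. *)

locale cstar_algebra = vector_space scaleC
  for scaleC :: "complex \<Rightarrow> 'a::{real_normed_algebra_1, banach} \<Rightarrow> 'a" +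
  fixes star :: "'a \<Rightarrow> 'a"
  assumes scaleC_of_real: "scaleC (complex_of_real r) x = r *\<^sub>R x"
    and scaleC_mult_left: "scaleC c x * y = scaleC c (x * y)"
    and scaleC_mult_right: "x * scaleC c y = scaleC c (x * y)"
    and norm_scaleC: "norm (scaleC c x) = cmod c * norm x"
    and star_add: "star (x + y) = star x + star y"
    and star_scaleC: "star (scaleC c x) = scaleC (cnj c) (star x)"
    and star_mult: "star (x * y) = star y * star x"
    and star_star: "star (star x) = x"
    and cstar_identity: "norm (star x * x) = (norm x)\<^sup>2"

locale cstar_probability_space = cstar_algebra scaleC star
  for scaleC :: "complex \<Rightarrow> 'a::{real_normed_algebra_1, banach} \<Rightarrow> 'a"
    and star :: "'a \<Rightarrow> 'a" +
  fixes \<phi> :: "'a \<Rightarrow> complex"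
  assumes state_linear: "Vector_Spaces.linear scaleC (*) \<phi>"
    and state_one: "\<phi> 1 = 1"
    and state_positive: "\<phi> (star x * x) \<in> \<real>\<^sub>\<ge>\<^sub>0"
    and state_faithful: "\<phi> (star x * x) = 0 \<Longrightarrow> x = 0"
    and state_tracial: "\<phi> (x * y) = \<phi> (y * x)"

definition positive_element :: "('a::times \<Rightarrow> 'a) \<Rightarrow> 'a \<Rightarrow> bool" where
  "positive_element star Z \<longleftrightarrow> (\<exists>y. Z = star y * y)"

definition positive_random_variable ::
  "(complex \<Rightarrow> 'a::{real_normed_algebra_1, banach} \<Rightarrow> 'a) \<Rightarrow> ('a \<Rightarrow> 'a) \<Rightarrow> ('a \<Rightarrow> complex) \<Rightarrow> 'a \<Rightarrow> bool"
  where
  "positive_random_variable scaleC star \<phi> Z \<longleftrightarrow>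
     cstar_probability_space scaleC star \<phi> \<and> positive_element star Z"

(* At most one mu satisfies this, since compactly supported measures are determined by
   their moments. *)
definition is_distribution_of ::
  "real measure \<Rightarrow> ('a::monoid_mult \<Rightarrow> complex) \<Rightarrow> 'a \<Rightarrow> bool" where
  "is_distribution_of \<mu> \<phi> Z \<longleftrightarrow>
     prob_space \<mu> \<and> sets \<mu> = sets borel \<and>
     (\<exists>K. compact K \<and> K \<subseteq> {0..} \<and> measure \<mu> K = 1) \<and>
     (\<forall>n. \<phi> (Z ^ n) = complex_of_real (\<integral>x. x ^ n \<partial>\<mu>))"

definition cauchy_transform :: "real measure \<Rightarrow> complex \<Rightarrow> complex" where
  "cauchy_transform \<mu> z = (\<integral>x. 1 / (z - complex_of_real x) \<partial>\<mu>)"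

definition kummer_equation ::
  "real \<Rightarrow> real \<Rightarrow> real \<Rightarrow> real \<Rightarrow> (complex \<Rightarrow> complex) \<Rightarrow> bool" where
  "kummer_equation \<alpha> \<beta> \<gamma> \<delta> G \<longleftrightarrow>
     (\<forall>z. z \<notin> \<real>\<^sub>\<ge>\<^sub>0 \<longrightarrow>
        z * (z + 1) * (G z)\<^sup>2
        - (of_real \<gamma> * z * (z + 1) - (of_real \<alpha> - 1) * (z + 1) + of_real \<beta> * z) * G z
        + of_real \<gamma> * z + of_real \<delta> = 0)"

(* The measure w * delta_0 + f(x) dx. *)
definition atom_plus_density :: "real \<Rightarrow> (real \<Rightarrow> real) \<Rightarrow> real measure" where
  "atom_plus_density w f =
     measure_of UNIV (sets borel)
       (\<lambda>A. ennreal w * indicator A 0 + (\<integral>\<^sup>+x\<in>A. ennreal (f x) \<partial>lborel))"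

lemma emeasure_atom_plus_density:
  assumes f: "f \<in> borel_measurable borel" and A: "A \<in> sets borel"
  shows "emeasure (atom_plus_density w f) A =
           ennreal w * indicator A 0 + (\<integral>\<^sup>+x\<in>A. ennreal (f x) \<partial>lborel)"
proof (rule emeasure_measure_of[OF atom_plus_density_def])
  let ?m = "\<lambda>A. ennreal w * indicator A (0::real) + (\<integral>\<^sup>+x\<in>A. ennreal (f x) \<partial>lborel)"
  show "sets borel \<subseteq> Pow (UNIV :: real set)" by simp
  show "A \<in> sets (atom_plus_density w f)"
    using A unfolding atom_plus_density_def by (simp add: sets.sigma_sets_eq[of borel, simplified])
  have eq: "?m B = emeasure (scale_measure (ennreal w) (return borel 0)) B
      + emeasure (density lborel (\<lambda>x. ennreal (f x))) B" if "B \<in> sets borel" for B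
    using that f by (simp add: emeasure_density)
  show "positive (sets (atom_plus_density w f)) ?m"
    by (simp add: positive_def)
  show "countably_additive (sets (atom_plus_density w f)) ?m"
  proof (rule countably_additiveI)
    fix B :: "nat \<Rightarrow> real set"
    assume B: "range B \<subseteq> sets (atom_plus_density w f)" and d: "disjoint_family B"
    have s: "sets (atom_plus_density w f) = sets borel"
      unfolding atom_plus_density_def by (simp add: sets.sigma_sets_eq[of borel, simplified])
    have B': "B i \<in> sets borel" for i using B s by auto
    have U: "(\<Union>i. B i) \<in> sets borel" using B' by auto
    have "(\<Sum>i. ?m (B i)) = (\<Sum>i. emeasure (scale_measure (ennreal w) (return borel 0)) (B i)
        + emeasure (density lborel (\<lambda>x. ennreal (f x))) (B i))"
      using eq[OF B'] by simp
    also have "\<dots> = (\<Sum>i. emeasure (scale_measure (ennreal w) (return borel 0)) (B i))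
        + (\<Sum>i. emeasure (density lborel (\<lambda>x. ennreal (f x))) (B i))"
      by (rule suminf_add[symmetric]) auto
    also have "\<dots> = emeasure (scale_measure (ennreal w) (return borel 0)) (\<Union>i. B i)
        + emeasure (density lborel (\<lambda>x. ennreal (f x))) (\<Union>i. B i)"
      using B' d by (subst (1 2) suminf_emeasure) (auto simp del: emeasure_scale_measure)
    also have "\<dots> = ?m (\<Union>i. B i)" using eq[OF U] by simp
    finally show "(\<Sum>i. ?m (B i)) = ?m (\<Union>i. B i)" .
  qed
qed

definition kummer_endpoints :: "real \<Rightarrow> real \<Rightarrow> real \<Rightarrow> real \<times> real" where
  "kummer_endpoints \<alpha> \<beta> \<gamma> =
     (THE (a, b). 0 < a \<and> a < b \<and>
        \<gamma> + \<beta> / sqrt ((a + 1) * (b + 1)) - \<bar>\<alpha> - 1\<bar> / sqrt (a * b) = 0 \<and>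
        \<gamma> * ((a + b) / 2) - \<alpha> + 1 + \<beta> - \<beta> / sqrt ((a + 1) * (b + 1)) = 2)"

definition kummer_density :: "real \<Rightarrow> real \<Rightarrow> real \<Rightarrow> real \<Rightarrow> real" where
  "kummer_density \<alpha> \<beta> \<gamma> x =
     (let (a, b) = kummer_endpoints \<alpha> \<beta> \<gamma> in
        1 / (2 * pi) * sqrt ((x - a) * (b - x)) *
        (\<bar>\<alpha> - 1\<bar> / (x * sqrt (a * b)) - \<beta> / ((1 + x) * sqrt ((a + 1) * (b + 1)))) *
        indicator {a<..<b} x)"

definition kummer_endpoint_one :: "real \<Rightarrow> real \<Rightarrow> real" where
  "kummer_endpoint_one \<beta> \<gamma> =
     (THE b. 0 < b \<and> \<gamma> * (b / 2) + \<beta> - \<beta> / sqrt (b + 1) = 2)"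

definition kummer_density_one :: "real \<Rightarrow> real \<Rightarrow> real \<Rightarrow> real" where
  "kummer_density_one \<beta> \<gamma> x =
     (let b = kummer_endpoint_one \<beta> \<gamma>; \<sigma> = \<gamma> + \<beta> / sqrt (b + 1) in
        1 / (2 * pi) * sqrt (x * (b - x)) *
        (\<sigma> / x - \<beta> / ((1 + x) * sqrt (b + 1))) *
        indicator {0<..<b} x)"

definition free_kummer :: "real \<Rightarrow> real \<Rightarrow> real \<Rightarrow> real measure" where
  "free_kummer \<alpha> \<beta> \<gamma> =
     (if \<alpha> \<noteq> 1 \<or> \<beta> < 1 - (1 + sqrt \<gamma>)\<^sup>2
      then atom_plus_density (max 0 (1 - \<alpha>)) (kummer_density \<alpha> \<beta> \<gamma>)
      else density lborel (\<lambda>x. ennreal (kummer_density_one \<beta> \<gamma> x)))"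

end

theory Submission
  imports Defs
begin

text \<open>
  With $P(z) = \gamma z(z+1) - (\alpha-1)(z+1) + \beta z$ and
  $D = P^2 - 4z(z+1)(\gamma z + \delta)$ the equation reads $H^2 = D$ for
  $H = 2z(z+1)G - P$. Near the positive axis $\mathrm{Im}\, G \le 0$ selects the root, so
  Stieltjes inversion gives $\mu$ on $(0,\infty)$ the density
  $\sqrt{\max(0,-D(x))}/(2\pi x(x+1))$ without choosing a branch of the square root.
  On the negative axis $H$ is real, so $D \ge 0$ there, and each zero $c$ of $H$ is a double
  zero of $D$. Since $H(-1) = \beta$, the intermediate value theorem gives $c \le -1$ if
  $\beta \ge 0$, and $-1 < c < 0$ if $\beta < 0$ and $\alpha > 1$. As $\mu \ne \delta_0$, $D$ is
  negative somewhere on $(0,\infty)$, hence $D = \gamma^2(x-c)^2(x-a)(x-b)$ with $0 \le a < b$.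
  Comparing values at $0$ and $-1$ (the location of $c$ fixes the signs of the square roots) and
  the cubic coefficients yields the equations for the end points, whose solution is unique;
  $a$, $b$, $c$ in turn determine $\delta$.
\<close>

section \<open>Stieltjes inversion\<close>

lemma integral_Poisson_kernel:
  fixes u v t y :: real
  assumes "0 < y" "u \<le> v"
  shows "(\<integral>x. (y / ((x - t)\<^sup>2 + y\<^sup>2)) * indicator {u..v} x \<partial>lborel) =
    arctan ((v - t) / y) - arctan ((u - t) / y)"
proof (rule integral_FTC_Icc_real[OF assms(2)])
  fix x :: real
  have "(x - t)\<^sup>2 + y\<^sup>2 > 0" using assms(1) by (simp add: add_nonneg_pos)
  then show "isCont (\<lambda>x. y / ((x - t)\<^sup>2 + y\<^sup>2)) x"
    by (intro continuous_intros) auto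
  have "((\<lambda>x. arctan ((x - t) / y)) has_real_derivative (inverse (1 + ((x - t) / y)\<^sup>2)) * (1 / y)) (at x)"
    using assms(1) by (auto intro!: derivative_eq_intros)
  moreover have "inverse (1 + ((x - t) / y)\<^sup>2) * (1 / y) = y / ((x - t)\<^sup>2 + y\<^sup>2)"
    using assms(1) \<open>(x - t)\<^sup>2 + y\<^sup>2 > 0\<close>
    by (simp add: divide_simps power2_eq_square add_nonneg_eq_0_iff)
  ultimately show "((\<lambda>x. arctan ((x - t) / y)) has_real_derivative y / ((x - t)\<^sup>2 + y\<^sup>2)) (at x)"
    by simp
qed

context real_distribution
begin

lemma integrable_cauchy_kernel:
  assumes "0 < Im z"
  shows "integrable M (\<lambda>t. 1 / (z - complex_of_real t))"
proof (rule integrable_const_bound[where B = "1 / Im z"])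
  have "cmod (1 / (z - complex_of_real t)) \<le> 1 / Im z" for t
    using assms abs_Im_le_cmod[of "z - complex_of_real t"]
    by (simp add: norm_divide divide_simps)
  then show "AE t in M. cmod (1 / (z - complex_of_real t)) \<le> 1 / Im z" by simp
qed simp

text \<open>Up to the factor pi, -Im G on a horizontal line is the Poisson smoothing of the measure.
  In particular Im G \<le> 0 above the axis, which later selects the root.\<close>

lemma Im_cauchy_transform:
  assumes "0 < y"
  shows "Im (cauchy_transform M (Complex x y)) = - (\<integral>t. y / ((x - t)\<^sup>2 + y\<^sup>2) \<partial>M)"
proof -
  have "Im (cauchy_transform M (Complex x y)) = (\<integral>t. Im (1 / (Complex x y - complex_of_real t)) \<partial>M)"
    unfolding cauchy_transform_def using integrable_cauchy_kernel[of "Complex x y"] assms by simp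
  also have "\<dots> = (\<integral>t. - (y / ((x - t)\<^sup>2 + y\<^sup>2)) \<partial>M)"
    by (simp add: Im_divide cmod_power2)
  finally show ?thesis by simp
qed

text \<open>Fubini: integrating the Poisson kernel over x first leaves a difference of arctangents.
  The kernel is at most 1/y and the strip \<open>{u..v} \<times> UNIV\<close> has finite measure, so
  the double integral converges absolutely.\<close>

lemma integral_Im_cauchy_transform:
  assumes y: "0 < y" and uv: "u \<le> v"
  shows "(\<integral>x. - Im (cauchy_transform M (Complex x y)) * indicator {u..v} x \<partial>lborel) =
    (\<integral>t. arctan ((v - t) / y) - arctan ((u - t) / y) \<partial>M)"
proof -
  interpret L: pair_sigma_finite lborel M ..
  define f where "f x t = (y / ((x - t)\<^sup>2 + y\<^sup>2)) * indicator {u..v} x" for x t :: real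
  have "integrable (lborel \<Otimes>\<^sub>M M) (\<lambda>p. indicator ({u..v} \<times> UNIV) p / y :: real)"
    using uv by (intro integrable_divide integrable_real_indicator)
      (auto simp: emeasure_pair_measure_Times ennreal_mult_less_top emeasure_eq_measure)
  then have "integrable (lborel \<Otimes>\<^sub>M M) (\<lambda>(x, t). f x t)"
  proof (rule Bochner_Integration.integrable_bound)
    show "(\<lambda>(x, t). f x t) \<in> borel_measurable (lborel \<Otimes>\<^sub>M M)" unfolding f_def by measurable
    have "norm (f x t) \<le> norm (indicator ({u..v} \<times> UNIV) (x, t) / y)" for x t
    proof -
      have "y / ((x - t)\<^sup>2 + y\<^sup>2) \<le> y / y\<^sup>2"
        using y by (intro divide_left_mono) (auto intro!: mult_pos_pos add_nonneg_pos)
      then show ?thesis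
        using y by (auto simp: f_def indicator_def power2_eq_square)
    qed
    then show "AE p in lborel \<Otimes>\<^sub>M M. norm (case p of (x, t) \<Rightarrow> f x t) \<le> norm (indicator ({u..v} \<times> UNIV) p / y)"
      by auto
  qed
  then have "(\<integral>t. \<integral>x. f x t \<partial>lborel \<partial>M) = (\<integral>x. \<integral>t. f x t \<partial>M \<partial>lborel)"
    by (rule L.Fubini_integral)
  also have "\<dots> = (\<integral>x. - Im (cauchy_transform M (Complex x y)) * indicator {u..v} x \<partial>lborel)"
    unfolding f_def Im_cauchy_transform[OF y] by (simp only: integral_mult_left_zero minus_minus)
  finally show ?thesis
    using integral_Poisson_kernel[OF y uv] by (simp add: f_def)
qed

text \<open>As the height 1/(n+1) tends to 0, the arctangent difference tends to pi inside the
  interval, to pi/2 at its end points and to 0 outside, and it is bounded by pi. Hence atoms at the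
  end points count half.\<close>

lemma tendsto_integral_arctan:
  assumes uv: "u < v"
  shows "(\<lambda>n. \<integral>t. arctan ((v - t) / (1 / Suc n)) - arctan ((u - t) / (1 / Suc n)) \<partial>M)
    \<longlonglongrightarrow> pi * (prob {u<..<v} + (prob {u} + prob {v}) / 2)"
proof -
  define s :: "real \<Rightarrow> real \<Rightarrow> real" where "s = (\<lambda>x t. pi / 2 * sgn (x - t))"
  have lim: "(\<lambda>n. arctan ((x - t) / (1 / Suc n))) \<longlonglongrightarrow> s x t" for x t :: real
  proof -
    have top: "filterlim (\<lambda>n. r * real (Suc n)) at_top sequentially" if "r > 0" for r
      using that by (intro filterlim_tendsto_pos_mult_at_top[OF tendsto_const])
        (auto intro: filterlim_compose[OF filterlim_real_sequentially filterlim_Suc] simp del: of_nat_Suc)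
    consider "x = t" | "x > t" | "x < t" by linarith
    then show ?thesis
    proof cases
      case 2
      then show ?thesis using tendsto_arctan_at_top[THEN filterlim_compose, OF top[of "x - t"]]
        by (simp add: s_def)
    next
      case 3
      then have "(\<lambda>n. - arctan ((t - x) * real (Suc n))) \<longlonglongrightarrow> - (pi / 2)"
        by (intro tendsto_minus tendsto_arctan_at_top[THEN filterlim_compose, OF top]) simp
      then show ?thesis using 3 by (simp add: s_def flip: arctan_minus) (simp add: algebra_simps)
    qed (simp add: s_def)
  qed
  have "(\<lambda>n. \<integral>t. arctan ((v - t) / (1 / Suc n)) - arctan ((u - t) / (1 / Suc n)) \<partial>M)
      \<longlonglongrightarrow> (\<integral>t. s v t - s u t \<partial>M)"
  proof (rule integral_dominated_convergence[where w = "\<lambda>_. pi"])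
    have "norm (arctan a - arctan b) \<le> pi" for a b
      using arctan_bounded[of a] arctan_bounded[of b] by (simp add: abs_if)
    then show "AE t in M. norm (arctan ((v - t) / (1 / Suc n)) - arctan ((u - t) / (1 / Suc n))) \<le> pi" for n
      by simp
    show "AE t in M. (\<lambda>n. arctan ((v - t) / (1 / Suc n)) - arctan ((u - t) / (1 / Suc n))) \<longlonglongrightarrow> s v t - s u t"
      by (intro AE_I2 tendsto_diff lim)
  qed (auto simp: s_def)
  also have "(\<integral>t. s v t - s u t \<partial>M) =
      (\<integral>t. pi * indicator {u<..<v} t + pi / 2 * indicator {u} t + pi / 2 * indicator {v} t \<partial>M)"
    using uv by (intro Bochner_Integration.integral_cong) (auto simp: s_def indicator_def sgn_if)
  also have "\<dots> = pi * prob {u<..<v} + pi / 2 * prob {u} + pi / 2 * prob {v}"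
  proof -
    have [simp]: "integrable M (indicator A :: real \<Rightarrow> real)" if "A \<in> sets borel" for A
      using that by (intro integrable_real_indicator) (auto simp: emeasure_eq_measure)
    show ?thesis by simp
  qed
  also have "\<dots> = pi * (prob {u<..<v} + (prob {u} + prob {v}) / 2)"
    by (simp add: field_simps)
  finally show ?thesis .
qed

text \<open>The limit of the integral of -Im G at height 1/(n+1) is evaluated twice: by dominated
  convergence from the bound \<open>B\<close>, and through the arctangents.\<close>

theorem Stieltjes_inversion:
  assumes uv: "u < v"
    and f [measurable]: "f \<in> borel_measurable borel"
    and bound: "\<And>x y. \<lbrakk>x \<in> {u..v}; 0 < y; y \<le> 1\<rbrakk> \<Longrightarrow> \<bar>Im (cauchy_transform M (Complex x y))\<bar> \<le> B"
    and lim: "\<And>x. x \<in> {u..v} \<Longrightarrow>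
      ((\<lambda>y. - Im (cauchy_transform M (Complex x y)) / pi) \<longlongrightarrow> f x) (at_right 0)"
  shows "prob {u<..<v} + (prob {u} + prob {v}) / 2 = (\<integral>x. f x * indicator {u..v} x \<partial>lborel)"
proof -
  let ?g = "\<lambda>n x. - Im (cauchy_transform M (Complex x (1 / Suc n))) * indicator {u..v} x"
  have right: "filterlim (\<lambda>n. 1 / real (Suc n)) (at_right 0) sequentially"
    unfolding filterlim_at using lim_1_over_n[THEN LIMSEQ_Suc] by (auto simp del: of_nat_Suc)
  have gM: "(\<lambda>x. - (\<integral>t. - (y / ((x - t)\<^sup>2 + y\<^sup>2)) \<partial>M)) \<in> borel_measurable lborel" for y :: real
    by measurable
  have "(\<lambda>n. \<integral>x. ?g n x \<partial>lborel) \<longlonglongrightarrow> (\<integral>x. (pi * f x) * indicator {u..v} x \<partial>lborel)"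
  proof (rule integral_dominated_convergence[where w = "\<lambda>x. B * indicator {u..v} x"])
    show "?g n \<in> borel_measurable lborel" for n
      using gM[of "1 / Suc n"] by (auto simp: Im_cauchy_transform)
    show "integrable lborel (\<lambda>x. B * indicator {u..v} x)"
      using uv by (intro integrable_mult_right integrable_real_indicator) auto
    have "(\<lambda>n. ?g n x) \<longlonglongrightarrow> pi * f x * indicator {u..v} x" for x
    proof (cases "x \<in> {u..v}")
      case True
      from filterlim_compose[OF lim[OF True] right]
      have "(\<lambda>n. pi * (- Im (cauchy_transform M (Complex x (1 / Suc n))) / pi)) \<longlonglongrightarrow> pi * f x"
        by (intro tendsto_mult tendsto_const)
      with True show ?thesis by simp
    qed simp
    then show "AE x in lborel. (\<lambda>n. ?g n x) \<longlonglongrightarrow> pi * f x * indicator {u..v} x" by simp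
    have "norm (?g n x) \<le> B * indicator {u..v} x" for n x
      using bound[of x "1 / Suc n"] by (auto simp: indicator_def)
    then show "AE x in lborel. norm (?g n x) \<le> B * indicator {u..v} x" for n by simp
  qed simp
  moreover have "(\<lambda>n. \<integral>x. ?g n x \<partial>lborel) = (\<lambda>n. \<integral>t. arctan ((v - t) / (1 / Suc n)) - arctan ((u - t) / (1 / Suc n)) \<partial>M)"
    using uv by (intro ext integral_Im_cauchy_transform) auto
  ultimately have "pi * (prob {u<..<v} + (prob {u} + prob {v}) / 2) = (\<integral>x. pi * (f x * indicator {u..v} x) \<partial>lborel)"
    using LIMSEQ_unique[OF tendsto_integral_arctan[OF uv]] by (simp add: mult.assoc)
  then show ?thesis by simp
qed


text \<open>Bounds are required only on compact intervals inside (l, \<infinity>), since G may blow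
  up at l. They make f locally bounded, which excludes atoms above l; bounded open intervals then
  have the right measure and exhaust the rays.\<close>

lemma Stieltjes_inversion_Ioi:
  assumes f [measurable]: "f \<in> borel_measurable borel" and f_nonneg: "\<And>x. 0 \<le> f x"
    and bound: "\<And>u v. \<lbrakk>l < u; u < v\<rbrakk> \<Longrightarrow> \<exists>B. \<forall>x\<in>{u..v}. \<forall>y\<in>{0<..1}.
      \<bar>Im (cauchy_transform M (Complex x y))\<bar> \<le> B"
    and lim: "\<And>x. l < x \<Longrightarrow>
      ((\<lambda>y. - Im (cauchy_transform M (Complex x y)) / pi) \<longlongrightarrow> f x) (at_right 0)"
    and x: "l \<le> x"
  shows "emeasure M {x<..} = emeasure (density lborel f) {x<..}"
proof -
  have f_bound: "\<exists>C. \<forall>x\<in>{u..v}. f x \<le> C" if uv: "l < u" "u < v" for u v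
  proof -
    obtain B where B: "\<And>x y. \<lbrakk>x \<in> {u..v}; 0 < y; y \<le> 1\<rbrakk> \<Longrightarrow> \<bar>Im (cauchy_transform M (Complex x y))\<bar> \<le> B"
      using bound[OF uv] by (metis greaterThanAtMost_iff)
    have "f x \<le> B / pi" if "x \<in> {u..v}" for x
    proof (rule tendsto_upperbound[OF lim])
      show "\<forall>\<^sub>F y in at_right 0. - Im (cauchy_transform M (Complex x y)) / pi \<le> B / pi"
        using eventually_at_right_less[of "0::real"] eventually_at_right_real[of 0 "1::real", simplified]
        by eventually_elim (use B[OF that] in \<open>fastforce intro!: divide_right_mono\<close>)
    qed (use that uv in auto)
    then show ?thesis by blast
  qed
  have inversion: "prob {u<..<v} + (prob {u} + prob {v}) / 2 = (\<integral>x. f x * indicator {u..v} x \<partial>lborel)"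
    if uv: "l < u" "u < v" for u v
  proof -
    obtain B where "\<And>x y. \<lbrakk>x \<in> {u..v}; 0 < y; y \<le> 1\<rbrakk> \<Longrightarrow> \<bar>Im (cauchy_transform M (Complex x y))\<bar> \<le> B"
      using bound[OF uv] by (metis greaterThanAtMost_iff)
    then show ?thesis
      using uv lim by (intro Stieltjes_inversion[of u v f B]) auto
  qed
  have singleton: "prob {u} = 0" if u: "l < u" for u
  proof -
    obtain C where C: "\<And>x. x \<in> {u..u + 1} \<Longrightarrow> f x \<le> C"
      using f_bound[of u "u + 1"] u by (metis less_add_one)
    have "0 \<le> C" using C[of u] f_nonneg[of u] by simp
    \<comment> \<open>Inversion on the short interval \<open>{u..u + e}\<close> counts at least half
      of the atom at u, while the integral of f there is at most C * e.\<close>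
    have "prob {u} / 2 \<le> C * e" if e: "0 < e" "e \<le> 1" for e
    proof -
      have "prob {u} / 2 \<le> (\<integral>x. f x * indicator {u..u + e} x \<partial>lborel)"
        using inversion[OF u less_add_same_cancel1[THEN iffD2, OF e(1)]]
          measure_nonneg[of M "{u<..<u + e}"] measure_nonneg[of M "{u + e}"] by argo
      also have "\<dots> \<le> (\<integral>x. C * indicator {u..u + e} x \<partial>lborel)"
      proof (rule integral_mono')
        show "integrable lborel (\<lambda>x. C * indicator {u..u + e} x)"
          using e by (intro integrable_mult_right integrable_real_indicator) auto
      qed (use C e \<open>0 \<le> C\<close> in \<open>auto simp: indicator_def\<close>)
      also have "\<dots> = C * e" using e by simp
      finally show ?thesis .
    qed
    moreover have "\<forall>\<^sub>F e in at_right 0. 0 < e \<and> e \<le> (1::real)"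
      using eventually_at_right_less[of "0::real"] eventually_at_right_real[of 0 "1::real", simplified]
      by eventually_elim simp
    ultimately have "\<forall>\<^sub>F e in at_right 0. prob {u} / 2 \<le> C * e"
      by (auto elim: eventually_mono)
    moreover have "((\<lambda>e. C * e) \<longlongrightarrow> C * 0) (at_right 0)"
      by (intro tendsto_intros)
    ultimately have "prob {u} / 2 \<le> C * 0"
      by (intro tendsto_lowerbound) auto
    then show ?thesis using measure_nonneg[of M "{u}"] by simp
  qed
  have interval: "emeasure M {u<..<v} = emeasure (density lborel f) {u<..<v}" if uv: "l < u" "u < v" for u v
  proof -
    obtain C where C: "\<And>x. x \<in> {u..v} \<Longrightarrow> f x \<le> C"
      using f_bound uv by blast
    have int: "integrable lborel (\<lambda>x. f x * indicator {u..v} x)"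
    proof (rule Bochner_Integration.integrable_bound)
      show "integrable lborel (\<lambda>x. C * indicator {u..v} x)"
        using uv by (intro integrable_mult_right integrable_real_indicator) auto
      show "AE x in lborel. norm (f x * indicator {u..v} x) \<le> norm (C * indicator {u..v} x)"
        using C f_nonneg by (intro AE_I2) (force simp: indicator_def)
    qed simp
    have "emeasure M {u<..<v} = ennreal (\<integral>x. f x * indicator {u..v} x \<partial>lborel)"
      using inversion[OF uv] singleton[of u] singleton[of v] uv by (simp add: emeasure_eq_measure)
    also have "\<dots> = (\<integral>\<^sup>+x. ennreal (f x * indicator {u..v} x) \<partial>lborel)"
      using int f_nonneg by (intro nn_integral_eq_integral[symmetric]) auto
    also have "\<dots> = (\<integral>\<^sup>+x. ennreal (f x) * indicator {u<..<v} x \<partial>lborel)"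
      using AE_lborel_singleton[of u] AE_lborel_singleton[of v]
      by (intro nn_integral_cong_AE) (auto simp: indicator_def)
    finally show ?thesis by (simp add: emeasure_density)
  qed
  \<comment> \<open>The left end stays strictly above x because \<open>interval\<close> needs
    \<open>l < u\<close> and x may equal l.\<close>
  define A where "A n = {x + 1 / Suc n<..<x + 1 + Suc n}" for n
  have "incseq A"
  proof (rule monoI)
    fix m n :: nat assume "m \<le> n"
    then have "1 / real (Suc n) \<le> 1 / real (Suc m)" by (simp add: frac_le)
    with \<open>m \<le> n\<close> show "A m \<le> A n" by (auto simp: A_def)
  qed
  have Un: "(\<Union>n. A n) = {x<..}"
  proof safe
    fix n y assume "y \<in> A n"
    then have "x + 1 / Suc n < y" by (simp add: A_def)
    moreover have "0 < 1 / real (Suc n)" by simp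
    ultimately show "x < y" by linarith
  next
    fix y assume "x < y"
    then obtain m where m: "1 / Suc m < y - x" using reals_Archimedean[of "y - x"] by (auto simp: inverse_eq_divide)
    obtain k where k: "y - x < real k" using reals_Archimedean2 by blast
    have "y \<in> A (m + k)"
    proof -
      have "1 / real (Suc (m + k)) \<le> 1 / Suc m" by (simp add: frac_le)
      then show ?thesis using m k unfolding A_def by (simp del: of_nat_Suc)
    qed
    then show "y \<in> (\<Union>n. A n)" by blast
  qed
  have "emeasure M (A n) = emeasure (density lborel f) (A n)" for n
  proof -
    have "0 < 1 / real (Suc n)" "1 / real (Suc n) \<le> 1" by (simp_all add: divide_simps)
    then show ?thesis unfolding A_def using x by (intro interval) linarith+
  qed
  moreover have "(SUP n. emeasure M (A n)) = emeasure M {x<..}"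
    using \<open>incseq A\<close> Un by (subst SUP_emeasure_incseq) (auto simp: A_def)
  moreover have "(SUP n. emeasure (density lborel f) (A n)) = emeasure (density lborel f) {x<..}"
    using \<open>incseq A\<close> Un by (subst SUP_emeasure_incseq) (auto simp: A_def)
  ultimately show ?thesis by simp
qed

end

section \<open>The density in terms of the discriminant\<close>

text \<open>Polymorphic, so that the complex equation and the real density share one polynomial;
  \<open>kummer_lin_of_real\<close> links the two uses.\<close>

definition kummer_lin :: "real \<Rightarrow> real \<Rightarrow> real \<Rightarrow> 'a::real_field \<Rightarrow> 'a" where
  "kummer_lin \<alpha> \<beta> \<gamma> z =
     of_real \<gamma> * z * (z + 1) - (of_real \<alpha> - 1) * (z + 1) + of_real \<beta> * z"

definition kummer_disc :: "real \<Rightarrow> real \<Rightarrow> real \<Rightarrow> real \<Rightarrow> 'a::real_field \<Rightarrow> 'a" where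
  "kummer_disc \<alpha> \<beta> \<gamma> \<delta> z =
     (kummer_lin \<alpha> \<beta> \<gamma> z)\<^sup>2 - 4 * z * (z + 1) * (of_real \<gamma> * z + of_real \<delta>)"

lemma kummer_lin_of_real: "kummer_lin \<alpha> \<beta> \<gamma> (of_real x) = of_real (kummer_lin \<alpha> \<beta> \<gamma> x)"
  by (simp add: kummer_lin_def)

lemma kummer_disc_of_real: "kummer_disc \<alpha> \<beta> \<gamma> \<delta> (of_real x) = of_real (kummer_disc \<alpha> \<beta> \<gamma> \<delta> x)"
  by (simp add: kummer_disc_def kummer_lin_of_real)

lemma continuous_on_kummer_lin [continuous_intros]:
  "continuous_on A (kummer_lin \<alpha> \<beta> \<gamma> :: 'a::{real_normed_field} \<Rightarrow> 'a)"
  unfolding kummer_lin_def by (intro continuous_intros)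

lemma continuous_on_kummer_disc [continuous_intros]:
  "continuous_on A (kummer_disc \<alpha> \<beta> \<gamma> \<delta> :: 'a::{real_normed_field} \<Rightarrow> 'a)"
  unfolding kummer_disc_def by (intro continuous_intros)

text \<open>The identity (Im w)^2 = (|w^2| - Re (w^2)) / 2 recovers |Im w| from w^2 alone, so no
  branch of the root is chosen. As p becomes real in the limit, Im g and Im (g - p) have the same
  limiting size, and Im g \<le> 0 settles the sign.\<close>

lemma tendsto_Im_quadratic_root:
  fixes g p :: "'a \<Rightarrow> complex"
  assumes sq: "((\<lambda>y. (g y - p y)\<^sup>2) \<longlongrightarrow> of_real d) F"
    and p: "(p \<longlongrightarrow> of_real q) F"
    and neg: "\<forall>\<^sub>F y in F. Im (g y) \<le> 0"
  shows "((\<lambda>y. - Im (g y)) \<longlongrightarrow> sqrt (max 0 (- d))) F"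
proof -
  have Im2: "(Im w)\<^sup>2 = (cmod (w\<^sup>2) - Re (w\<^sup>2)) / 2" for w
    by (simp add: norm_power cmod_power2) (simp add: power2_eq_square)
  have "((\<lambda>y. (cmod ((g y - p y)\<^sup>2) - Re ((g y - p y)\<^sup>2)) / 2) \<longlongrightarrow> (cmod (of_real d) - Re (of_real d)) / 2) F"
    by (intro tendsto_intros sq) simp
  then have "((\<lambda>y. (Im (g y - p y))\<^sup>2) \<longlongrightarrow> max 0 (- d)) F"
    unfolding Im2 by (auto simp: max_def abs_if split: if_splits)
  then have 1: "((\<lambda>y. \<bar>Im (g y - p y)\<bar>) \<longlongrightarrow> sqrt (max 0 (- d))) F"
    by (drule_tac tendsto_real_sqrt) simp
  have 2: "((\<lambda>y. \<bar>Im (p y)\<bar>) \<longlongrightarrow> 0) F"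
    using tendsto_rabs[OF tendsto_Im[OF p]] by simp
  have lower: "((\<lambda>y. \<bar>Im (g y - p y)\<bar> - \<bar>Im (p y)\<bar>) \<longlongrightarrow> sqrt (max 0 (- d))) F"
    and upper: "((\<lambda>y. \<bar>Im (g y - p y)\<bar> + \<bar>Im (p y)\<bar>) \<longlongrightarrow> sqrt (max 0 (- d))) F"
    using tendsto_diff[OF 1 2] tendsto_add[OF 1 2] by simp_all
  show ?thesis
    by (rule tendsto_sandwich[OF _ _ lower upper]; use neg in eventually_elim; simp add: abs_if)
qed

section \<open>Boundary values of the transform on the positive axis\<close>

locale kummer_distribution = real_distribution M
  for M :: "real measure" +
  fixes \<alpha> \<beta> \<gamma> \<delta> :: real
  assumes AE_nonneg: "AE t in M. 0 \<le> t"
    and alpha_pos: "0 < \<alpha>" and gamma_pos: "0 < \<gamma>"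
    and equation: "kummer_equation \<alpha> \<beta> \<gamma> \<delta> (cauchy_transform M)"
    and beta_or_alpha: "0 \<le> \<beta> \<or> 1 < \<alpha>"
begin

abbreviation "P \<equiv> kummer_lin \<alpha> \<beta> \<gamma>"
abbreviation "D \<equiv> kummer_disc \<alpha> \<beta> \<gamma> \<delta>"

text \<open>Completing the square: the two sides differ by 4z(z+1) times the left side of the
  equation.\<close>

lemma cauchy_transform_square:
  assumes "z \<notin> \<real>\<^sub>\<ge>\<^sub>0"
  shows "(2 * z * (z + 1) * cauchy_transform M z - P z)\<^sup>2 = D z"
proof -
  have "z * (z + 1) * (cauchy_transform M z)\<^sup>2 - P z * cauchy_transform M z + of_real \<gamma> * z + of_real \<delta> = 0"
    using equation assms unfolding kummer_equation_def kummer_lin_def by blast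
  then show ?thesis unfolding kummer_disc_def by algebra
qed

definition f :: "real \<Rightarrow> real" where
  "f x = sqrt (max 0 (- D x)) / (2 * pi * x * (x + 1)) * indicator {0<..} x"

lemma f_nonneg: "0 \<le> f x"
  by (auto simp: f_def indicator_def)

lemma borel_measurable_f [measurable]: "f \<in> borel_measurable borel"
proof -
  have [measurable]: "(D :: real \<Rightarrow> real) \<in> borel_measurable borel"
    by (intro borel_measurable_continuous_onI continuous_intros)
  show ?thesis unfolding f_def by measurable
qed

lemma Complex_notin_nonneg_Reals: "0 < y \<Longrightarrow> Complex x y \<notin> \<real>\<^sub>\<ge>\<^sub>0"
  by (auto simp: complex_nonneg_Reals_iff)

lemma cauchy_transform_square':
  assumes "z \<notin> \<real>\<^sub>\<ge>\<^sub>0" "z \<noteq> -1"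
  shows "(cauchy_transform M z - P z / (2 * z * (z + 1)))\<^sup>2 = D z / (2 * z * (z + 1))\<^sup>2"
proof -
  have "2 * z * (z + 1) \<noteq> 0" using assms by (auto simp: eq_neg_iff_add_eq_0)
  then have "cauchy_transform M z - P z / (2 * z * (z + 1))
      = (2 * z * (z + 1) * cauchy_transform M z - P z) / (2 * z * (z + 1))"
    by (simp add: diff_divide_distrib)
  then show ?thesis
    by (simp only: power_divide cauchy_transform_square[OF assms(1)])
qed

lemma tendsto_Im_cauchy_transform:
  assumes x: "0 < x"
  shows "((\<lambda>y. - Im (cauchy_transform M (Complex x y)) / pi) \<longlongrightarrow> f x) (at_right 0)"
proof -
  let ?z = "\<lambda>y. Complex x y"
  have z: "(?z \<longlongrightarrow> of_real x) (at_right 0)"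
    unfolding complex_of_real_def by (intro tendsto_intros)
  have ev: "\<forall>\<^sub>F y in at_right 0. 0 < (y::real)" by (rule eventually_at_right_less)
  have nz: "2 * complex_of_real x * (complex_of_real x + 1) \<noteq> 0"
    using x by (simp add: complex_eq_iff)
  have DP: "((\<lambda>y. D (?z y)) \<longlongrightarrow> D (complex_of_real x)) (at_right 0)"
    "((\<lambda>y. P (?z y)) \<longlongrightarrow> P (complex_of_real x)) (at_right 0)"
    by (intro isCont_tendsto_compose[OF _ z]
        continuous_on_interior[OF continuous_on_kummer_disc[of UNIV]]
        continuous_on_interior[OF continuous_on_kummer_lin[of UNIV]]; simp)+
  let ?d = "D x / (2 * x * (x + 1))\<^sup>2"
  have "((\<lambda>y. - Im (cauchy_transform M (?z y))) \<longlongrightarrow> sqrt (max 0 (- ?d))) (at_right 0)"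
  proof (rule tendsto_Im_quadratic_root[where p = "\<lambda>y. P (?z y) / (2 * ?z y * (?z y + 1))"
        and q = "P x / (2 * x * (x + 1))"])
    have "((\<lambda>y. D (?z y) / (2 * ?z y * (?z y + 1))\<^sup>2) \<longlongrightarrow>
        D (complex_of_real x) / (2 * complex_of_real x * (complex_of_real x + 1))\<^sup>2) (at_right 0)"
      using nz by (intro tendsto_intros DP z) auto
    also have "D (complex_of_real x) / (2 * complex_of_real x * (complex_of_real x + 1))\<^sup>2 = of_real ?d"
      by (simp add: kummer_disc_of_real)
    finally show "((\<lambda>y. (cauchy_transform M (?z y) - P (?z y) / (2 * ?z y * (?z y + 1)))\<^sup>2) \<longlongrightarrow> of_real ?d) (at_right 0)"
    proof (rule Lim_transform_eventually)
      show "\<forall>\<^sub>F y in at_right 0. D (?z y) / (2 * ?z y * (?z y + 1))\<^sup>2 =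
          (cauchy_transform M (?z y) - P (?z y) / (2 * ?z y * (?z y + 1)))\<^sup>2"
        using ev by eventually_elim
          (use x in \<open>auto simp: cauchy_transform_square' Complex_notin_nonneg_Reals complex_eq_iff\<close>)
    qed
    have "((\<lambda>y. P (?z y) / (2 * ?z y * (?z y + 1))) \<longlongrightarrow>
        P (complex_of_real x) / (2 * complex_of_real x * (complex_of_real x + 1))) (at_right 0)"
      using nz by (intro tendsto_intros DP z) auto
    then show "((\<lambda>y. P (?z y) / (2 * ?z y * (?z y + 1))) \<longlongrightarrow> of_real (P x / (2 * x * (x + 1)))) (at_right 0)"
      by (simp add: kummer_lin_of_real)
    show "\<forall>\<^sub>F y in at_right 0. Im (cauchy_transform M (?z y)) \<le> 0"
      using ev by eventually_elim (auto simp: Im_cauchy_transform intro!: integral_nonneg_AE)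
  qed
  then have "((\<lambda>y. - Im (cauchy_transform M (?z y)) / pi) \<longlongrightarrow> sqrt (max 0 (- ?d)) / pi) (at_right 0)"
    by (intro tendsto_intros) auto
  moreover have "sqrt (max 0 (- ?d)) / pi = f x"
  proof -
    have "max 0 (- ?d) = max 0 (- D x) / (2 * x * (x + 1))\<^sup>2"
      by (auto simp: max_def divide_simps)
    then show ?thesis using x by (simp add: f_def real_sqrt_divide)
  qed
  ultimately show ?thesis by simp
qed

text \<open>The square from \<open>cauchy_transform_square'\<close> bounds |G| by the sum
  \<open>?h\<close>, which is continuous on the closed rectangle [u,v] x [0,1], away from 0 and -1.
  So the bound is uniform down to the real axis.\<close>

lemma bounded_Im_cauchy_transform:
  assumes u: "0 < u"
  shows "\<exists>B. \<forall>x\<in>{u..v}. \<forall>y\<in>{0<..1}. \<bar>Im (cauchy_transform M (Complex x y))\<bar> \<le> B"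
proof -
  let ?K = "cbox (Complex u 0) (Complex v 1)"
  let ?h = "\<lambda>z. cmod (P z / (2 * z * (z + 1))) + sqrt (cmod (D z / (2 * z * (z + 1))\<^sup>2))"
  have nz: "2 * z * (z + 1) \<noteq> 0" if "z \<in> ?K" for z
  proof -
    have "0 < Re z" using that u by (simp add: in_cbox_complex_iff)
    then have "z \<noteq> 0" "z + 1 \<noteq> 0" by (auto simp: complex_eq_iff)
    then show ?thesis by simp
  qed
  have "compact (?h ` ?K)"
    using nz by (intro compact_continuous_image compact_cbox continuous_intros) auto
  then obtain B where B: "\<And>z. z \<in> ?K \<Longrightarrow> ?h z \<le> B"
    using compact_imp_bounded bounded_imp_bdd_above by (fastforce simp: bdd_above_def)
  have "\<bar>Im (cauchy_transform M (Complex x y))\<bar> \<le> B" if "x \<in> {u..v}" "y \<in> {0<..1}" for x y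
  proof -
    let ?z = "Complex x y"
    have K: "?z \<in> ?K" using that by (simp add: in_cbox_complex_iff)
    let ?w = "cauchy_transform M ?z - P ?z / (2 * ?z * (?z + 1))"
    have "\<bar>Im (cauchy_transform M ?z)\<bar> \<le> cmod (P ?z / (2 * ?z * (?z + 1)) + ?w)"
      using abs_Im_le_cmod[of "cauchy_transform M ?z"] by simp
    also have "\<dots> \<le> cmod (P ?z / (2 * ?z * (?z + 1))) + cmod ?w" by (rule norm_triangle_ineq)
    also have "cmod ?w = sqrt (cmod (?w\<^sup>2))" by (simp add: norm_power)
    also have "?w\<^sup>2 = D ?z / (2 * ?z * (?z + 1))\<^sup>2"
      using that nz[OF K] by (intro cauchy_transform_square' Complex_notin_nonneg_Reals) auto
    finally show ?thesis using B[OF K] by linarith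
  qed
  then show ?thesis by blast
qed

text \<open>Finite measures that agree on all rays are equal. Inversion handles the rays from x
  \<ge> 0; a ray from x < 0 carries the whole mass, which is that of {0} plus that of (0,
  \<infinity>).\<close>

theorem eq_atom_plus_density: "M = atom_plus_density (prob {0}) f"
proof (rule measure_eqI_lessThan)
  show sets: "sets (atom_plus_density (prob {0}) f) = sets borel"
    unfolding atom_plus_density_def by (simp add: sets.sigma_sets_eq[of borel, simplified])
  fix x :: real
  show "emeasure M {x<..} < \<infinity>" by (simp add: emeasure_eq_measure)
  have Ioi: "emeasure M {y<..} = (\<integral>\<^sup>+t\<in>{y<..}. ennreal (f t) \<partial>lborel)" if "0 \<le> y" for y
    using Stieltjes_inversion_Ioi[OF borel_measurable_f f_nonneg bounded_Im_cauchy_transform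
        tendsto_Im_cauchy_transform that]
    by (simp add: emeasure_density)
  show "emeasure M {x<..} = emeasure (atom_plus_density (prob {0}) f) {x<..}"
  proof (cases "0 \<le> x")
    case True
    then show ?thesis by (simp add: emeasure_atom_plus_density Ioi)
  next
    case False
    have "emeasure M {x<..} = emeasure M ({0} \<union> {0<..})"
      using AE_nonneg False by (intro emeasure_eq_AE) (auto elim!: eventually_mono)
    also have "\<dots> = emeasure M {0} + emeasure M {0<..}"
      by (intro plus_emeasure[symmetric]) auto
    also have "\<dots> = ennreal (prob {0}) + (\<integral>\<^sup>+t\<in>{0<..}. ennreal (f t) \<partial>lborel)"
      using Ioi[of 0] by (simp add: emeasure_eq_measure)
    also have "(\<integral>\<^sup>+t\<in>{0<..}. ennreal (f t) \<partial>lborel) = (\<integral>\<^sup>+t\<in>{x<..}. ennreal (f t) \<partial>lborel)"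
      using False by (intro nn_integral_cong) (auto simp: f_def indicator_def)
    finally show ?thesis using False by (simp add: emeasure_atom_plus_density)
  qed
qed simp

end

section \<open>The discriminant on the negative axis\<close>

text \<open>Division of D by (x - c)^2 leaves the remainder D'(c)(x - c), as D(c) = 0. It vanishes
  because D has a local minimum at c.\<close>

lemma quartic_double_root:
  fixes D :: "real \<Rightarrow> real"
  assumes D: "\<And>x. D x = k4 * x^4 + k3 * x^3 + k2 * x\<^sup>2 + k1 * x + k0"
    and c: "D c = 0" "c < r" and nonneg: "\<And>x. x < r \<Longrightarrow> 0 \<le> D x"
  shows "D x = (x - c)\<^sup>2 * (k4 * x\<^sup>2 + (k3 + 2 * c * k4) * x + (k2 + 2 * c * k3 + 3 * c\<^sup>2 * k4))"
proof -
  define Q where "Q x = k4 * x\<^sup>2 + (k3 + 2 * c * k4) * x + (k2 + 2 * c * k3 + 3 * c\<^sup>2 * k4)" for x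
  define l where "l = k1 + 2 * c * k2 + 3 * c\<^sup>2 * k3 + 4 * c^3 * k4"
  have split: "D x = (x - c)\<^sup>2 * Q x + l * (x - c)" for x
  proof -
    have "D x = (x - c)\<^sup>2 * Q x + l * (x - c) + D c"
      unfolding D Q_def l_def
      by (simp add: algebra_simps power2_eq_square power3_eq_cube power4_eq_xxxx)
    with c show ?thesis by simp
  qed
  have "((\<lambda>x. (x - c)\<^sup>2 * Q x + l * (x - c)) has_real_derivative l) (at c)"
    unfolding Q_def by (auto intro!: derivative_eq_intros)
  then have "(D has_real_derivative l) (at c)"
    unfolding split[abs_def, symmetric] .
  then have "l = 0"
  proof (rule DERIV_local_min)
    show "0 < r - c" using c by simp
    show "\<forall>y. \<bar>c - y\<bar> < r - c \<longrightarrow> D c \<le> D y"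
      unfolding c(1) by (intro allI impI nonneg) linarith
  qed
  then show ?thesis unfolding split Q_def by simp
qed

section \<open>The real transform on the negative axis, the atom at 0 and the zeros of D\<close>

context kummer_distribution
begin

definition g :: "real \<Rightarrow> real" where
  "g x = expectation (\<lambda>t. 1 / (x - t))"

lemma integrable_g:
  assumes "x < 0"
  shows "integrable M (\<lambda>t. 1 / (x - t))"
proof (rule integrable_const_bound[where B = "1 / - x"])
  have "norm (1 / (x - t)) \<le> 1 / - x" if "0 \<le> t" for t
  proof -
    have "norm (1 / (x - t)) = 1 / (t - x)"
      using that assms by (simp only: norm_divide real_norm_def abs_of_neg) simp
    also have "\<dots> \<le> 1 / - x"
      using that assms by (intro frac_le) auto
    finally show ?thesis .
  qed
  then show "AE t in M. norm (1 / (x - t)) \<le> 1 / - x"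
    by (rule AE_mp[OF AE_nonneg AE_I2[OF impI]])
qed simp

lemma cauchy_transform_of_real: "cauchy_transform M (of_real x) = of_real (g x)"
proof -
  have "1 / (complex_of_real x - of_real t) = of_real (1 / (x - t))" for t
    by simp
  then have "cauchy_transform M (of_real x) = (\<integral>t. complex_of_real (1 / (x - t)) \<partial>M)"
    unfolding cauchy_transform_def by (simp only:)
  also have "\<dots> = of_real (g x)"
    unfolding g_def by (rule integral_complex_of_real)
  finally show ?thesis .
qed

lemma g_nonpos:
  assumes "x < 0"
  shows "g x \<le> 0"
proof -
  have "0 \<le> - (1 / (x - t))" if "0 \<le> t" for t
    using that assms by (simp add: divide_nonneg_nonpos)
  then have "0 \<le> expectation (\<lambda>t. - (1 / (x - t)))"
    by (rule integral_nonneg_AE[OF AE_mp[OF AE_nonneg AE_I2[OF impI]]])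
  then show ?thesis by (simp add: g_def)
qed

text \<open>Resolvent identity: the integrands differ by (y-x)/((t-x)(t-y)), whose denominator is at
  least xy for t \<ge> 0. This gives the continuity that the intermediate value theorem
  needs.\<close>

lemma dist_g_le:
  assumes "x < 0" "y < 0"
  shows "\<bar>g x - g y\<bar> \<le> \<bar>x - y\<bar> / (x * y)"
proof -
  have "g x - g y = expectation (\<lambda>t. 1 / (x - t) - 1 / (y - t))"
    unfolding g_def using assms integrable_g by simp
  also have "\<bar>\<dots>\<bar> \<le> \<bar>x - y\<bar> / (x * y)"
  proof -
    have "norm (1 / (x - t) - 1 / (y - t)) \<le> \<bar>x - y\<bar> / (x * y)" if "0 \<le> t" for t
    proof -
      have "1 / (x - t) - 1 / (y - t) = (y - x) / ((t - x) * (t - y))"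
        using assms that by (simp add: divide_simps) (simp add: algebra_simps)
      moreover have "x * y \<le> (t - x) * (t - y)"
        using mult_mono[of "- x" "t - x" "- y" "t - y"] assms that by simp
      ultimately show ?thesis
        using assms that by (auto simp: abs_mult abs_minus_commute mult_neg_neg intro!: divide_left_mono)
    qed
    then have "AE t in M. norm (1 / (x - t) - 1 / (y - t)) \<le> \<bar>x - y\<bar> / (x * y)"
      by (rule AE_mp[OF AE_nonneg AE_I2[OF impI]])
    then have "norm (expectation (\<lambda>t. 1 / (x - t) - 1 / (y - t))) \<le> expectation (\<lambda>t. \<bar>x - y\<bar> / (x * y))"
      using assms integrable_g
      by (intro order_trans[OF integral_norm_bound] integral_mono_AE) auto
    then show ?thesis using prob_space by simp
  qed
  finally show ?thesis .
qed

lemma continuous_on_g: "continuous_on {..<0} g"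
proof (intro continuous_at_imp_continuous_on ballI)
  fix y :: real assume "y \<in> {..<0}"
  then have y: "y < 0" by simp
  have "(g \<longlongrightarrow> g y) (at y)"
  proof (rule LIM_zero_cancel, rule Lim_null_comparison)
    have "((\<lambda>x. \<bar>x - y\<bar> / (x * y)) \<longlongrightarrow> \<bar>y - y\<bar> / (y * y)) (at y)"
      using y by (intro tendsto_divide tendsto_rabs tendsto_diff tendsto_mult tendsto_ident_at tendsto_const) simp
    then show "((\<lambda>x. \<bar>x - y\<bar> / (x * y)) \<longlongrightarrow> 0) (at y)" by simp
    have "\<forall>\<^sub>F x in at y. x < 0"
      using tendsto_ident_at y by (rule order_tendstoD(2))
    then show "\<forall>\<^sub>F x in at y. norm (g x - g y) \<le> \<bar>x - y\<bar> / (x * y)"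
      using dist_g_le[OF _ y] unfolding real_norm_def by (rule eventually_mono)
  qed
  then show "isCont g y" by (simp only: isCont_def)
qed

text \<open>The function H of the proof idea on the negative axis: a continuous real square root of
  D that may change sign.\<close>

definition h :: "real \<Rightarrow> real" where
  "h x = 2 * x * (x + 1) * g x - P x"

lemma h_square:
  assumes "x < 0"
  shows "(h x)\<^sup>2 = D x"
proof -
  have "complex_of_real ((h x)\<^sup>2) = (2 * of_real x * (of_real x + 1) * cauchy_transform M (of_real x) - P (of_real x))\<^sup>2"
    by (simp add: h_def cauchy_transform_of_real kummer_lin_of_real)
  also have "\<dots> = of_real (D x)"
    using assms by (subst cauchy_transform_square) (auto simp: kummer_disc_of_real)
  finally show ?thesis by (simp only: of_real_eq_iff)
qed

lemma D_nonneg: "x < 0 \<Longrightarrow> 0 \<le> D (x::real)"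
  by (simp flip: h_square)

lemma continuous_on_h: "continuous_on {..<0} h"
  unfolding h_def by (intro continuous_intros continuous_on_g)

text \<open>The quadratic arranged so that g enters the second factor only through x * g x, whose
  limit at 0 from the left is the atom at 0. Cancelling 4x(x+1) excludes -1.\<close>

lemma g_equation:
  assumes "x < 0" "x \<noteq> -1"
  shows "g x * (P x - (x + 1) * (x * g x)) = \<gamma> * x + \<delta>"
proof -
  have "4 * x * (x + 1) * (g x * (P x - (x + 1) * (x * g x)) - (\<gamma> * x + \<delta>)) = D x - (h x)\<^sup>2"
    unfolding kummer_disc_def h_def of_real_eq_id id_apply by algebra
  then show ?thesis using assms by (simp add: h_square)
qed

lemma h_minus_one: "h (-1) = \<beta>"
  by (simp add: h_def kummer_lin_def)

text \<open>At z = -1 the quadratic term vanishes.\<close>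

lemma delta_eq: "\<delta> = \<gamma> - \<beta> * g (-1)"
proof -
  have "complex_of_real (\<beta> * g (-1) - \<gamma> + \<delta>) = 0"
    using equation[unfolded kummer_equation_def, rule_format, of "-1"] cauchy_transform_of_real[of "-1"]
    by (simp add: complex_nonneg_Reals_iff)
  then have "\<beta> * g (-1) - \<gamma> + \<delta> = 0" by (simp only: of_real_eq_0_iff)
  then show ?thesis by simp
qed

text \<open>For x < 0 \<le> t the quotient x/(x-t) lies in [0,1]; as x rises to 0 it tends to 1 if t
  = 0 and to 0 otherwise.\<close>

lemma tendsto_mult_g: "(\<lambda>n. (- 1 / Suc n) * g (- 1 / Suc n)) \<longlonglongrightarrow> prob {0}"
proof -
  let ?x = "\<lambda>n. - 1 / real (Suc n)"
  have x: "?x n < 0" for n by simp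
  have x0: "?x \<longlonglongrightarrow> 0"
    using tendsto_minus[OF lim_1_over_n[THEN LIMSEQ_Suc]] by simp
  have "(\<lambda>n. expectation (\<lambda>t. ?x n / (?x n - t))) \<longlonglongrightarrow> expectation (indicator {0})"
  proof (rule integral_dominated_convergence[where w = "\<lambda>_. 1"])
    show "AE t in M. (\<lambda>n. ?x n / (?x n - t)) \<longlonglongrightarrow> indicator {0} t"
      using AE_nonneg
    proof eventually_elim
      case (elim t)
      show ?case
      proof (cases "t = 0")
        case False
        have "(\<lambda>n. ?x n / (?x n - t)) \<longlonglongrightarrow> 0 / (0 - t)"
          using False by (intro tendsto_divide tendsto_diff x0 tendsto_const) auto
        with False show ?thesis by simp
      qed simp
    qed
    have "norm (y / (y - t)) \<le> 1" if "y < 0" "0 \<le> t" for y t :: real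
      using that by (simp add: abs_if divide_simps)
    from this[OF x] show "AE t in M. norm (?x n / (?x n - t)) \<le> 1" for n
      by (rule AE_mp[OF AE_nonneg AE_I2[OF impI]])
  qed auto
  moreover have eq: "expectation (\<lambda>t. y / (y - t)) = y * g y" for y
    unfolding g_def by (simp flip: integral_mult_right_zero)
  moreover have ind: "expectation (indicator {0}) = prob {0}" by simp
  ultimately show ?thesis by (simp only: eq ind)
qed

text \<open>Letting x rise to 0 in h^2 = D gives (2w + \<alpha> - 1)^2 = (\<alpha> - 1)^2 for the
  atom w, hence w = 0 or w = 1 - \<alpha>. For \<alpha> \<ge> 1 the sign of w decides; for \<alpha>
  < 1 the value 0 has to be refuted.\<close>

lemma prob_zero: "prob {0} = max 0 (1 - \<alpha>)"
proof -
  let ?x = "\<lambda>n. - 1 / real (Suc n)"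
  have x: "?x n < 0" for n by simp
  have x0: "?x \<longlonglongrightarrow> 0"
    using tendsto_minus[OF lim_1_over_n[THEN LIMSEQ_Suc]] by simp
  have P: "(\<lambda>n. P (?x n)) \<longlonglongrightarrow> P 0" and D: "(\<lambda>n. D (?x n)) \<longlonglongrightarrow> D 0"
    by (intro isCont_tendsto_compose[OF _ x0]
        continuous_on_interior[OF continuous_on_kummer_disc[of UNIV]]
        continuous_on_interior[OF continuous_on_kummer_lin[of UNIV]]; simp)+
  have "(\<lambda>n. (2 * (?x n + 1) * (?x n * g (?x n)) - P (?x n))\<^sup>2) \<longlonglongrightarrow> (2 * (0 + 1) * prob {0} - P 0)\<^sup>2"
    by (intro tendsto_intros tendsto_mult_g x0 P)
  moreover have "(2 * (y + 1) * (y * g y) - P y)\<^sup>2 = D y" if "y < 0" for y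
    using h_square[OF that] by (simp add: h_def mult_ac)
  ultimately have "(\<lambda>n. D (?x n)) \<longlonglongrightarrow> (2 * (0 + 1) * prob {0} - P 0)\<^sup>2"
    using x by (simp only:)
  from LIMSEQ_unique[OF this D] have "(2 * prob {0} + (\<alpha> - 1))\<^sup>2 = (\<alpha> - 1)\<^sup>2"
    by (simp add: kummer_lin_def kummer_disc_def power2_commute[of 1 \<alpha>] algebra_simps)
  then have w: "prob {0} = 0 \<or> prob {0} = 1 - \<alpha>"
    by (auto simp: power2_eq_iff)
  have "prob {0} \<noteq> 0" if "\<alpha> < 1"
  proof
    txt \<open>Then $G$ would be bounded at $0$ with $G(0-) = \delta/(1-\alpha)$; but $G < 0 < \delta$.\<close>
    assume w0: "prob {0} = 0"
    \<comment> \<open>Here \<alpha> < 1 leaves only \<beta> \<ge> 0, so \<open>delta_eq\<close> with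
      g(-1) \<le> 0 gives \<delta> \<ge> \<gamma>.\<close>
    have "0 < \<delta>"
      using delta_eq gamma_pos beta_or_alpha that g_nonpos[of "-1"] mult_nonneg_nonpos[of \<beta> "g (-1)"] by auto
    have "(\<lambda>n. P (?x n) - (?x n + 1) * (?x n * g (?x n))) \<longlonglongrightarrow> P 0 - (0 + 1) * prob {0}"
      by (intro tendsto_intros tendsto_mult_g x0 P)
    then have "\<forall>\<^sub>F n in sequentially. P (?x n) - (?x n + 1) * (?x n * g (?x n)) > 0"
      using that w0 by (intro order_tendstoD(1)) (auto simp: kummer_lin_def)
    moreover have "(\<lambda>n. \<gamma> * ?x n + \<delta>) \<longlonglongrightarrow> \<gamma> * 0 + \<delta>"
      by (intro tendsto_intros x0)
    then have "\<forall>\<^sub>F n in sequentially. \<gamma> * ?x n + \<delta> > 0"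
      using \<open>0 < \<delta>\<close> by (intro order_tendstoD(1)) auto
    moreover have "\<forall>\<^sub>F n in sequentially. -1 < ?x n"
      using x0 by (rule order_tendstoD(1)) simp
    ultimately have "\<forall>\<^sub>F n in sequentially. False"
    proof eventually_elim
      case (elim n)
      have "\<gamma> * ?x n + \<delta> = g (?x n) * (P (?x n) - (?x n + 1) * (?x n * g (?x n)))"
        using elim(3) x[of n] by (intro g_equation[symmetric]) auto
      also have "\<dots> \<le> 0"
        using g_nonpos[OF x[of n]] elim(1) by (intro mult_nonpos_nonneg) auto
      finally show False using elim(2) by linarith
    qed
    then show False by simp
  qed
  moreover have "prob {0} = 0" if "1 \<le> \<alpha>"
    using w that measure_nonneg[of M "{0}"] by linarith
  ultimately show ?thesis using w by (cases "\<alpha> < 1") auto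
qed

lemma h_zero: "\<exists>c<0. h c = 0 \<and> (0 \<le> \<beta> \<longrightarrow> c \<le> -1) \<and> (\<beta> < 0 \<longrightarrow> -1 < c)"
proof (cases "0 \<le> \<beta>")
  case True
  \<comment> \<open>Chosen to make P(-1-s) \<ge> 0: P(-1-s) + \<beta> is s times a bracket that this
    s makes at least \<beta>. As x(x+1)g(x) \<le> 0 left of -1, this gives h(-1-s) \<le> 0 \<le>
    \<beta> = h(-1).\<close>
  define s where "s = 1 + (2 * \<beta> + \<bar>\<alpha> - 1\<bar>) / \<gamma>"
  have "1 \<le> s" and \<gamma>s: "\<gamma> * s = \<gamma> + 2 * \<beta> + \<bar>\<alpha> - 1\<bar>"
    using True gamma_pos by (auto simp: s_def field_simps)
  have "\<beta> \<le> s * \<beta>" using \<open>1 \<le> s\<close> True by (simp add: mult_le_cancel_right1)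
  also have "\<dots> \<le> s * (\<gamma> + \<gamma> * s + \<alpha> - 1 - \<beta>)"
    using \<gamma>s \<open>1 \<le> s\<close> gamma_pos by (intro mult_left_mono) linarith+
  finally have "0 \<le> P (- 1 - s)" by (simp add: kummer_lin_def algebra_simps)
  moreover have "2 * (- 1 - s) * (- 1 - s + 1) * g (- 1 - s) \<le> 0"
    using \<open>1 \<le> s\<close> g_nonpos by (intro mult_nonneg_nonpos mult_nonpos_nonpos) auto
  ultimately have "h (- 1 - s) \<le> 0" by (simp add: h_def)
  then have "\<exists>c\<ge>- 1 - s. c \<le> -1 \<and> h c = 0"
    using \<open>1 \<le> s\<close> True
    by (intro IVT' continuous_on_subset[OF continuous_on_h]) (auto simp: h_minus_one)
  then obtain c where "c \<le> -1" "h c = 0" by blast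
  then show ?thesis using True by (intro exI[of _ c]) auto
next
  case False
  then have "1 < \<alpha>" using beta_or_alpha by auto
  \<comment> \<open>Chosen so that in P(-r) = -\<gamma> * r(1-r) - (\<alpha>-1) +
    r(\<alpha>-1-\<beta>) the last term cancels half of \<alpha>-1. Then P(-r) < 0, and x(x+1)g(x)
    \<ge> 0 between -1 and 0, so h(-1) < 0 \<le> h(-r).\<close>
  define r where "r = (\<alpha> - 1) / (2 * (\<alpha> - 1 - \<beta>))"
  have r: "0 < r" "r < 1" and rr: "r * (\<alpha> - 1 - \<beta>) = (\<alpha> - 1) / 2"
    using False \<open>1 < \<alpha>\<close> by (auto simp: r_def field_simps)
  define k where "k = \<gamma> * (r * (1 - r))"
  have Pr: "P (- r) = - k - (\<alpha> - 1) / 2"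
  proof -
    have "P (- r) = - k - (\<alpha> - 1) + r * (\<alpha> - 1 - \<beta>)"
      by (simp add: kummer_lin_def k_def algebra_simps)
    then show ?thesis unfolding rr by argo
  qed
  have "0 < k" using r gamma_pos by (simp add: k_def)
  moreover have "0 < (\<alpha> - 1) / 2" using \<open>1 < \<alpha>\<close> by simp
  ultimately have "- k - (\<alpha> - 1) / 2 \<le> 0" by linarith
  with Pr have "P (- r) \<le> 0" by (rule ord_eq_le_trans)
  moreover have "0 \<le> 2 * (- r) * (- r + 1) * g (- r)"
  proof -
    have "0 \<le> 2 * r * (1 - r) * (- g (- r))"
      using r g_nonpos[of "- r"] by (intro mult_nonneg_nonneg) auto
    then show ?thesis by (simp add: algebra_simps)
  qed
  ultimately have "0 \<le> h (- r)" by (simp add: h_def)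
  then have "\<exists>c\<ge>- 1. c \<le> - r \<and> h c = 0"
    using r False
    by (intro IVT' continuous_on_subset[OF continuous_on_h]) (auto simp: h_minus_one)
  then obtain c where "-1 \<le> c" "c \<le> - r" "h c = 0" by blast
  moreover have "c \<noteq> -1" using \<open>h c = 0\<close> h_minus_one False by auto
  ultimately show ?thesis using False r by (intro exI[of _ c]) auto
qed

text \<open>Otherwise the density vanishes and M is concentrated at 0, but the atom there has mass
  max 0 (1 - \<alpha>) < 1.\<close>

lemma D_neg: "\<exists>x>0. D (x::real) < 0"
proof (rule ccontr)
  assume "\<not> ?thesis"
  then have "f x = 0" for x by (auto simp: f_def indicator_def max_def not_less)
  then have "1 = emeasure (atom_plus_density (prob {0}) (\<lambda>_. 0)) UNIV"
    using eq_atom_plus_density emeasure_space_1 by (metis ext space_eq_univ)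
  also have "\<dots> = ennreal (prob {0})" by (subst emeasure_atom_plus_density) auto
  finally have "prob {0} = 1" by (metis ennreal_eq_1)
  then show False using prob_zero alpha_pos by (auto simp: max_def split: if_splits)
qed

lemma D_factorization:
  obtains a b c where "0 \<le> a" "a < b" "c < 0"
    "\<And>x. D x = \<gamma>\<^sup>2 * (x - c)\<^sup>2 * ((x - a) * (x - b))"
    "\<gamma> * (2 * c + a + b) = 4 - 2 * (\<gamma> - \<alpha> + 1 + \<beta>)"
    "\<bar>\<alpha> - 1\<bar> = - \<gamma> * c * sqrt (a * b)"
    "\<beta> = - \<gamma> * (1 + c) * sqrt ((a + 1) * (b + 1))"
proof -
  obtain c where c: "c < 0" "h c = 0" and c1: "0 \<le> \<beta> \<Longrightarrow> c \<le> -1" and c2: "\<beta> < 0 \<Longrightarrow> -1 < c"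
    using h_zero by blast
  \<comment> \<open>The linear coefficient of P. Below, \<open>q1\<close> and \<open>q0\<close> are
    the coefficients that \<open>quartic_double_root\<close> gives for the quotient of D by (x -
    c)^2.\<close>
  define m where "m = \<gamma> - \<alpha> + 1 + \<beta>"
  define q1 where "q1 = 2 * \<gamma> * m - 4 * \<gamma> + 2 * c * \<gamma>\<^sup>2"
  define k2 where "k2 = m\<^sup>2 - 2 * \<gamma> * (\<alpha> - 1) - 4 * (\<delta> + \<gamma>)"
  define q0 where "q0 = k2 + 2 * c * (2 * \<gamma> * m - 4 * \<gamma>) + 3 * c\<^sup>2 * \<gamma>\<^sup>2"
  define Q where "Q x = \<gamma>\<^sup>2 * x\<^sup>2 + q1 * x + q0" for x
  have DQ: "D x = (x - c)\<^sup>2 * Q x" for x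
    unfolding Q_def q1_def q0_def
  proof (rule quartic_double_root)
    show "D x = \<gamma>\<^sup>2 * x^4 + (2 * \<gamma> * m - 4 * \<gamma>) * x^3 + k2 * x\<^sup>2 + (- 2 * m * (\<alpha> - 1) - 4 * \<delta>) * x + (\<alpha> - 1)\<^sup>2" for x
      unfolding kummer_disc_def kummer_lin_def k2_def m_def of_real_eq_id id_apply by algebra
  qed (use c h_square[OF c(1)] D_nonneg in auto)
  obtain x0 :: real where x0: "0 < x0" "D x0 < 0" using D_neg by blast
  then have Qx0: "Q x0 < 0" using DQ by (metis mult_nonneg_nonneg not_less zero_le_power2)
  define s where "s = sqrt (q1\<^sup>2 - 4 * \<gamma>\<^sup>2 * q0)"
  \<comment> \<open>Completing the square at \<open>x0\<close>: a quadratic with positive leading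
    coefficient and a negative value has positive discriminant.\<close>
  have "q1\<^sup>2 - 4 * \<gamma>\<^sup>2 * q0 = (2 * \<gamma>\<^sup>2 * x0 + q1)\<^sup>2 - 4 * \<gamma>\<^sup>2 * Q x0"
    unfolding Q_def by algebra
  also have "\<dots> > 0"
    using Qx0 gamma_pos by (intro diff_gt_0_iff_gt[THEN iffD2] order.strict_trans2[OF _ zero_le_power2] mult_pos_neg) auto
  finally have s: "0 < s" "s\<^sup>2 = q1\<^sup>2 - 4 * \<gamma>\<^sup>2 * q0" unfolding s_def by auto
  define a b where "a = (- q1 - s) / (2 * \<gamma>\<^sup>2)" and "b = (- q1 + s) / (2 * \<gamma>\<^sup>2)"
  have ab: "a < b" using s gamma_pos by (auto simp: a_def b_def divide_strict_right_mono)
  have sum: "\<gamma>\<^sup>2 * (a + b) = - q1" using gamma_pos by (simp add: a_def b_def field_simps)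
  have prod: "\<gamma>\<^sup>2 * (a * b) = q0"
  proof -
    have "2 * \<gamma>\<^sup>2 * a = - q1 - s" "2 * \<gamma>\<^sup>2 * b = - q1 + s"
      using gamma_pos by (simp_all add: a_def b_def)
    then have "4 * \<gamma>\<^sup>2 * (\<gamma>\<^sup>2 * (a * b)) = 4 * \<gamma>\<^sup>2 * q0"
      using s(2) by algebra
    then show ?thesis using gamma_pos by simp
  qed
  have Q: "Q x = \<gamma>\<^sup>2 * ((x - a) * (x - b))" for x
  proof -
    have "Q x = \<gamma>\<^sup>2 * x\<^sup>2 - \<gamma>\<^sup>2 * (a + b) * x + \<gamma>\<^sup>2 * (a * b)"
      unfolding Q_def sum prod by simp
    also have "\<dots> = \<gamma>\<^sup>2 * ((x - a) * (x - b))" by algebra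
    finally show ?thesis .
  qed
  have D: "D x = \<gamma>\<^sup>2 * (x - c)\<^sup>2 * ((x - a) * (x - b))" for x
    unfolding DQ Q by (simp add: algebra_simps)
  have "(x0 - a) * (x0 - b) < 0" using Qx0 gamma_pos unfolding Q by (simp add: mult_less_0_iff)
  then have "0 < b" using ab x0 by (auto simp: mult_less_0_iff)
  have a: "0 \<le> a"
  proof (rule ccontr)
    assume "\<not> 0 \<le> a"
    \<comment> \<open>If a < 0, then D is negative on (a, 0) except at c. Of a/2 and a/3 at least
      one avoids c.\<close>
    obtain x where x: "a < x" "x < 0" "x \<noteq> c"
      using \<open>\<not> 0 \<le> a\<close> by (cases "a / 2 = c") (auto intro: that[of "a / 2"] that[of "a / 3"])
    then have "D x < 0"
      unfolding D using \<open>0 < b\<close> gamma_pos by (intro mult_pos_neg mult_pos_pos) auto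
    then show False using D_nonneg[of x] x by simp
  qed
  have "\<gamma> * (\<gamma> * (2 * c + a + b)) = 2 * c * \<gamma>\<^sup>2 + \<gamma>\<^sup>2 * (a + b)"
    by (simp add: power2_eq_square algebra_simps)
  also have "\<dots> = \<gamma> * (4 - 2 * m)"
    unfolding sum q1_def by (simp add: algebra_simps)
  finally have e1: "\<gamma> * (2 * c + a + b) = 4 - 2 * m" using gamma_pos by simp
  \<comment> \<open>Both sides are nonnegative because c < 0, and both squares equal D(0).\<close>
  have e2: "\<bar>\<alpha> - 1\<bar> = - \<gamma> * c * sqrt (a * b)"
  proof (rule power2_eq_imp_eq)
    have "\<bar>\<alpha> - 1\<bar>\<^sup>2 = D 0" by (simp add: kummer_disc_def kummer_lin_def power2_commute)
    also have "\<dots> = (- \<gamma> * c * sqrt (a * b))\<^sup>2"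
      unfolding D using a \<open>0 < b\<close> by (simp add: power_mult_distrib)
    finally show "\<bar>\<alpha> - 1\<bar>\<^sup>2 = (- \<gamma> * c * sqrt (a * b))\<^sup>2" .
    have "0 \<le> \<gamma> * (- c) * sqrt (a * b)"
      using c gamma_pos a \<open>0 < b\<close> by (intro mult_nonneg_nonneg) auto
    then show "0 \<le> - \<gamma> * c * sqrt (a * b)" by simp
  qed simp
  have e3: "\<beta> = - \<gamma> * (1 + c) * sqrt ((a + 1) * (b + 1))"
  proof -
    have "\<beta>\<^sup>2 = D (-1)" by (simp add: kummer_disc_def kummer_lin_def)
    also have "\<dots> = (- \<gamma> * (1 + c) * sqrt ((a + 1) * (b + 1)))\<^sup>2"
    proof -
      have "(sqrt ((a + 1) * (b + 1)))\<^sup>2 = (a + 1) * (b + 1)" using a \<open>0 < b\<close> by simp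
      moreover have "D (-1) = \<gamma>\<^sup>2 * (1 + c)\<^sup>2 * ((a + 1) * (b + 1))" unfolding D by algebra
      ultimately show ?thesis by (simp add: power_mult_distrib)
    qed
    finally have sq: "\<beta>\<^sup>2 = (- \<gamma> * (1 + c) * sqrt ((a + 1) * (b + 1)))\<^sup>2" .
    have pos: "0 < \<gamma> * sqrt ((a + 1) * (b + 1))" using a \<open>0 < b\<close> gamma_pos by simp
    define p where "p = \<gamma> * sqrt ((a + 1) * (b + 1))"
    have p: "- \<gamma> * (1 + c) * sqrt ((a + 1) * (b + 1)) = - (1 + c) * p"
      by (simp add: p_def algebra_simps)
    \<comment> \<open>By the choice of c, 1 + c \<le> 0 if \<beta> \<ge> 0 and 1 + c > 0 if \<beta>
      < 0. So the opposite sign is possible only if both sides vanish.\<close>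
    have "\<beta> = - (1 + c) * p"
    proof (rule power2_eq_iff[THEN iffD1, THEN disjE])
      show "\<beta>\<^sup>2 = (- (1 + c) * p)\<^sup>2" using sq unfolding p .
      assume "\<beta> = - (- (1 + c) * p)"
      then have \<beta>: "\<beta> = (1 + c) * p" by (simp add: algebra_simps)
      have "0 < p" using pos by (simp add: p_def)
      show "\<beta> = - (1 + c) * p"
      proof (cases "0 \<le> \<beta>")
        case True
        then have "(1 + c) * p \<le> 0"
          using c1 \<open>0 < p\<close> by (intro mult_nonpos_nonneg) auto
        then have "(1 + c) * p = 0" using True \<beta> by linarith
        with \<beta> show ?thesis by (simp only: mult_minus_left minus_zero)
      next
        case False
        then have "0 < (1 + c) * p"
          using c2 \<open>0 < p\<close> by (intro mult_pos_pos) auto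
        then show ?thesis using False \<beta> by linarith
      qed
    qed
    then show ?thesis unfolding p .
  qed
  show thesis
    using that[OF a ab c(1) D e1[unfolded m_def] e2 e3] .
qed

end

section \<open>The end points of the support\<close>

text \<open>
  The end point equations in the variables $p = \sqrt{ab}$, $q = \sqrt{(a+1)(b+1)}$, for which
  $q^2 - p^2 = a + b + 1$, and $a < b$ means $p + 1 < q$. For $\beta \ge 0$ the first equation
  makes $q - p$ increase with $q$; for $\beta < 0$ it makes $p$ decrease.
\<close>
lemma kummer_sqrt_endpoints_not_less:
  fixes A \<beta> \<gamma> p\<^sub>1 p\<^sub>2 q\<^sub>1 q\<^sub>2 k :: real
  assumes \<gamma>: "0 < \<gamma>"
    and p: "0 < p\<^sub>1" "0 < p\<^sub>2" and q: "p\<^sub>1 + 1 < q\<^sub>1" "p\<^sub>2 + 1 < q\<^sub>2" "q\<^sub>1 < q\<^sub>2"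
    and A: "0 < A" "p\<^sub>1 * (\<gamma> * q\<^sub>1 + \<beta>) = A * q\<^sub>1" "p\<^sub>2 * (\<gamma> * q\<^sub>2 + \<beta>) = A * q\<^sub>2"
    and k: "\<gamma> * (q\<^sub>1\<^sup>2 - p\<^sub>1\<^sup>2) / 2 - \<beta> / q\<^sub>1 = k" "\<gamma> * (q\<^sub>2\<^sup>2 - p\<^sub>2\<^sup>2) / 2 - \<beta> / q\<^sub>2 = k"
  shows False
proof -
  \<comment> \<open>Eliminating \<gamma> ties the sign of \<open>p\<^sub>2 - p\<^sub>1\<close> to
    that of \<beta>.\<close>
  have cross: "A * q\<^sub>1 * q\<^sub>2 * (p\<^sub>2 - p\<^sub>1) = p\<^sub>1 * p\<^sub>2 * \<beta> * (q\<^sub>2 - q\<^sub>1)"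
    using A(2,3) by algebra
  show False
  proof (cases "0 \<le> \<beta>")
    case True
    \<comment> \<open>Dropping the \<gamma> term turns \<open>cross\<close> into a bound on the
      growth of p by that of q. Then q^2 - p^2 increases strictly and -\<beta>/q does not decrease,
      against the common value k.\<close>
    have "p\<^sub>1 * \<beta> \<le> p\<^sub>1 * (\<gamma> * q\<^sub>1 + \<beta>)"
      using p q \<gamma> by (intro mult_left_mono) auto
    then have "p\<^sub>1 * \<beta> \<le> A * q\<^sub>1" using A by simp
    then have "(p\<^sub>1 * \<beta>) * (p\<^sub>2 * (q\<^sub>2 - q\<^sub>1)) \<le> (A * q\<^sub>1) * (p\<^sub>2 * (q\<^sub>2 - q\<^sub>1))"
      using p q by (intro mult_right_mono) auto
    then have "(A * q\<^sub>1) * (q\<^sub>2 * (p\<^sub>2 - p\<^sub>1)) \<le> (A * q\<^sub>1) * (p\<^sub>2 * (q\<^sub>2 - q\<^sub>1))"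
      using cross by (simp add: algebra_simps)
    then have "q\<^sub>2 * (p\<^sub>2 - p\<^sub>1) \<le> p\<^sub>2 * (q\<^sub>2 - q\<^sub>1)"
      using p q A by (subst (asm) mult_le_cancel_left_pos) auto
    also have "\<dots> \<le> q\<^sub>2 * (q\<^sub>2 - q\<^sub>1)"
      using p q by (intro mult_right_mono) auto
    finally have le: "p\<^sub>2 - p\<^sub>1 \<le> q\<^sub>2 - q\<^sub>1"
      using p q by (subst (asm) mult_le_cancel_left_pos) auto
    have "(p\<^sub>2 - p\<^sub>1) * (p\<^sub>1 + p\<^sub>2) \<le> (q\<^sub>2 - q\<^sub>1) * (p\<^sub>1 + p\<^sub>2)"
      using le p by (intro mult_right_mono) auto
    also have "\<dots> < (q\<^sub>2 - q\<^sub>1) * (q\<^sub>1 + q\<^sub>2)"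
      using p q by (intro mult_strict_left_mono) auto
    finally have "q\<^sub>1\<^sup>2 - p\<^sub>1\<^sup>2 < q\<^sub>2\<^sup>2 - p\<^sub>2\<^sup>2"
      by (simp add: power2_eq_square algebra_simps)
    then have "\<gamma> * (q\<^sub>1\<^sup>2 - p\<^sub>1\<^sup>2) < \<gamma> * (q\<^sub>2\<^sup>2 - p\<^sub>2\<^sup>2)" using \<gamma> by simp
    moreover have "\<beta> / q\<^sub>2 \<le> \<beta> / q\<^sub>1" using True p q by (intro divide_left_mono) auto
    ultimately show False using k by argo
  next
    case False
    have "0 < p\<^sub>1 * (\<gamma> * q\<^sub>1 + \<beta>)" using A p q by simp
    then have q1: "- \<beta> < \<gamma> * q\<^sub>1" using p by (simp add: zero_less_mult_iff)
    have "p\<^sub>1 * p\<^sub>2 * \<beta> * (q\<^sub>2 - q\<^sub>1) \<le> 0"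
      using False p q by (intro mult_nonpos_nonneg mult_nonneg_nonpos) auto
    then have "(A * q\<^sub>1 * q\<^sub>2) * (p\<^sub>2 - p\<^sub>1) \<le> 0" using cross by simp
    then have "p\<^sub>2 \<le> p\<^sub>1" using A p q by (auto simp: mult_le_0_iff)
    then have "p\<^sub>2\<^sup>2 \<le> p\<^sub>1\<^sup>2" using p by (intro power_mono) auto
    then have 1: "\<gamma> * p\<^sub>2\<^sup>2 \<le> \<gamma> * p\<^sub>1\<^sup>2" using \<gamma> by simp
    have "1 < q\<^sub>1" "1 < q\<^sub>2" using p q by auto
    \<comment> \<open>This makes \<gamma> * q^2/2 - \<beta>/q strictly larger at
      \<open>q\<^sub>2\<close>: the chord slope is \<open>\<gamma> * (q\<^sub>1 + q\<^sub>2) / 2 +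
      \<beta> / (q\<^sub>1 * q\<^sub>2)\<close>, positive as both q exceed 1 and
      \<open>- \<beta> < \<gamma> * q\<^sub>1\<close>.\<close>
    have "- \<beta> / (q\<^sub>1 * q\<^sub>2) < - \<beta>"
      using False less_1_mult[OF \<open>1 < q\<^sub>1\<close> \<open>1 < q\<^sub>2\<close>] \<open>1 < q\<^sub>1\<close> \<open>1 < q\<^sub>2\<close>
      by (simp add: divide_simps)
    also note q1
    also have "\<gamma> * q\<^sub>1 \<le> \<gamma> * ((q\<^sub>1 + q\<^sub>2) / 2)" using \<gamma> q by (intro mult_left_mono) auto
    finally have "- \<beta> / (q\<^sub>1 * q\<^sub>2) * (q\<^sub>2 - q\<^sub>1) < \<gamma> * ((q\<^sub>1 + q\<^sub>2) / 2) * (q\<^sub>2 - q\<^sub>1)"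
      using q by (intro mult_strict_right_mono) auto
    moreover have "- \<beta> / (q\<^sub>1 * q\<^sub>2) * (q\<^sub>2 - q\<^sub>1) = \<beta> / q\<^sub>2 - \<beta> / q\<^sub>1"
      using \<open>1 < q\<^sub>1\<close> \<open>1 < q\<^sub>2\<close> by (simp add: field_simps)
    moreover have "\<gamma> * ((q\<^sub>1 + q\<^sub>2) / 2) * (q\<^sub>2 - q\<^sub>1) = (\<gamma> * q\<^sub>2\<^sup>2 - \<gamma> * q\<^sub>1\<^sup>2) / 2"
      by (simp add: power2_eq_square algebra_simps)
    ultimately have "\<beta> / q\<^sub>2 - \<beta> / q\<^sub>1 < (\<gamma> * q\<^sub>2\<^sup>2 - \<gamma> * q\<^sub>1\<^sup>2) / 2" by (simp only:)
    then show False using 1 k unfolding right_diff_distrib by argo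
  qed
qed

definition is_kummer_endpoints :: "real \<Rightarrow> real \<Rightarrow> real \<Rightarrow> real \<Rightarrow> real \<Rightarrow> bool" where
  "is_kummer_endpoints \<alpha> \<beta> \<gamma> a b \<longleftrightarrow> 0 < a \<and> a < b \<and>
     \<gamma> + \<beta> / sqrt ((a + 1) * (b + 1)) - \<bar>\<alpha> - 1\<bar> / sqrt (a * b) = 0 \<and>
     \<gamma> * ((a + b) / 2) - \<alpha> + 1 + \<beta> - \<beta> / sqrt ((a + 1) * (b + 1)) = 2"

lemma is_kummer_endpoints_sqrt:
  assumes "is_kummer_endpoints \<alpha> \<beta> \<gamma> a b"
  defines "p \<equiv> sqrt (a * b)" and "q \<equiv> sqrt ((a + 1) * (b + 1))"
  shows "0 < p" "p + 1 < q" "p * (\<gamma> * q + \<beta>) = \<bar>\<alpha> - 1\<bar> * q"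
    "\<gamma> * (q\<^sup>2 - p\<^sup>2) / 2 - \<beta> / q = 1 + \<alpha> - \<beta> + \<gamma> / 2" "p\<^sup>2 = a * b" "q\<^sup>2 = (a + 1) * (b + 1)"
proof -
  have ab: "0 < a" "a < b" and e1: "\<gamma> + \<beta> / q - \<bar>\<alpha> - 1\<bar> / p = 0"
    and e2: "\<gamma> * ((a + b) / 2) - \<alpha> + 1 + \<beta> - \<beta> / q = 2"
    using assms unfolding is_kummer_endpoints_def by auto
  show p: "0 < p" using ab by (simp add: p_def)
  show p2: "p\<^sup>2 = a * b" and q2: "q\<^sup>2 = (a + 1) * (b + 1)"
    using ab by (simp_all add: p_def q_def)
  \<comment> \<open>Strict inequality of the means; q^2 - (p+1)^2 = a + b - 2p.\<close>
  have "0 < (sqrt b - sqrt a)\<^sup>2" using ab by simp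
  then have "2 * p < a + b"
    using ab by (simp add: power2_diff p_def real_sqrt_mult mult_ac add_ac)
  then have "(p + 1)\<^sup>2 < q\<^sup>2" unfolding q2 power2_sum p2 by (simp add: algebra_simps)
  then show pq: "p + 1 < q" 
    by (rule power_less_imp_less_base) (use ab in \<open>simp add: q_def\<close>)
  show "p * (\<gamma> * q + \<beta>) = \<bar>\<alpha> - 1\<bar> * q" using e1 p pq by (simp add: field_simps)
  have "\<gamma> * (q\<^sup>2 - p\<^sup>2) / 2 = \<gamma> * ((a + b) / 2) + \<gamma> / 2"
    unfolding p2 q2 by (simp add: algebra_simps)
  then show "\<gamma> * (q\<^sup>2 - p\<^sup>2) / 2 - \<beta> / q = 1 + \<alpha> - \<beta> + \<gamma> / 2" using e2 by linarith
qed

text \<open>For \<alpha> \<noteq> 1 the constant |\<alpha> - 1| is positive, and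
  \<open>kummer_sqrt_endpoints_not_less\<close> in both orders makes q unique. The second equation
  then fixes ab, hence also a + b, and a < b orders the two roots.\<close>

lemma kummer_endpoints_eq:
  assumes "0 < \<gamma>" "\<alpha> \<noteq> 1" and ab: "is_kummer_endpoints \<alpha> \<beta> \<gamma> a b"
  shows "kummer_endpoints \<alpha> \<beta> \<gamma> = (a, b)"
proof -
  have eq: "a' = a \<and> b' = b" if ab': "is_kummer_endpoints \<alpha> \<beta> \<gamma> a' b'" for a' b'
  proof -
    let ?p = "\<lambda>a b. sqrt (a * b)" and ?q = "\<lambda>a b. sqrt ((a + 1) * (b + 1))"
    note s = is_kummer_endpoints_sqrt[OF ab] and s' = is_kummer_endpoints_sqrt[OF ab']
    have q: "?q a b = ?q a' b'"
    proof (rule ccontr)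
      assume "?q a b \<noteq> ?q a' b'"
      then consider "?q a b < ?q a' b'" | "?q a' b' < ?q a b" by linarith
      then show False
      proof cases
        case 1
        from kummer_sqrt_endpoints_not_less[OF assms(1) s(1) s'(1) s(2) s'(2) 1 _ s(3) s'(3) s(4) s'(4)]
        show False using assms(2) by simp
      next
        case 2
        from kummer_sqrt_endpoints_not_less[OF assms(1) s'(1) s(1) s'(2) s(2) 2 _ s'(3) s(3) s'(4) s(4)]
        show False using assms(2) by simp
      qed
    qed
    have "\<gamma> * ((?q a' b')\<^sup>2 - (?p a b)\<^sup>2) / 2 = \<gamma> * ((?q a' b')\<^sup>2 - (?p a' b')\<^sup>2) / 2"
      using s(4) s'(4) unfolding q by linarith
    then have "a * b = a' * b'" unfolding s(5) s'(5) using assms(1) by simp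
    moreover have "(?q a b)\<^sup>2 = (?q a' b')\<^sup>2" by (simp only: q)
    then have "(a + 1) * (b + 1) = (a' + 1) * (b' + 1)" unfolding s(6) s'(6) .
    ultimately have sum: "a + b = a' + b'" by (simp add: algebra_simps)
    with \<open>a * b = a' * b'\<close> have "(a' - a) * (a' - b) = 0" by algebra
    then show ?thesis using sum ab ab' by (auto simp: is_kummer_endpoints_def)
  qed
  have "kummer_endpoints \<alpha> \<beta> \<gamma> = (THE (a, b). is_kummer_endpoints \<alpha> \<beta> \<gamma> a b)"
    unfolding kummer_endpoints_def is_kummer_endpoints_def ..
  also have "\<dots> = (a, b)"
  proof (rule the_equality)
    show "case (a, b) of (a, b) \<Rightarrow> is_kummer_endpoints \<alpha> \<beta> \<gamma> a b" using ab by simp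
    fix x assume "case x of (a, b) \<Rightarrow> is_kummer_endpoints \<alpha> \<beta> \<gamma> a b"
    then show "x = (a, b)" using eq by (cases x) simp
  qed
  finally show ?thesis .
qed

text \<open>For \<beta> \<ge> 0 the left side of the equation increases strictly with b. This serves
  the case \<alpha> = 1, where \<beta> \<ge> 0 holds.\<close>

lemma kummer_endpoint_one_eq:
  assumes "0 < \<gamma>" "0 \<le> \<beta>" and b: "0 < b" "\<gamma> * (b / 2) + \<beta> - \<beta> / sqrt (b + 1) = 2"
  shows "kummer_endpoint_one \<beta> \<gamma> = b"
proof -
  have less: "\<gamma> * (x / 2) + \<beta> - \<beta> / sqrt (x + 1) < \<gamma> * (y / 2) + \<beta> - \<beta> / sqrt (y + 1)"
    if "0 < x" "x < y" for x y
  proof -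
    have "\<gamma> * (x / 2) < \<gamma> * (y / 2)" using that assms by simp
    moreover have "\<beta> / sqrt (y + 1) \<le> \<beta> / sqrt (x + 1)"
      using that assms by (intro divide_left_mono) auto
    ultimately show ?thesis by linarith
  qed
  show ?thesis
    unfolding kummer_endpoint_one_def
  proof (rule the_equality)
    fix b' assume b': "0 < b' \<and> \<gamma> * (b' / 2) + \<beta> - \<beta> / sqrt (b' + 1) = 2"
    then show "b' = b"
      using b less[of b b'] less[of b' b] by (cases b b' rule: linorder_cases) auto
  qed (use b in auto)
qed

section \<open>Identification of the density with the free-Kummer density\<close>

context kummer_distribution
begin

text \<open>For \<alpha> \<noteq> 1 the values of D at -1 and 0 give two expressions for \<gamma> *
  c; equating them is the first end point equation, and eliminating c from the cubic coefficient
  gives the second. If \<alpha> = 1, then D(0) = 0 with c < 0 forces a = 0.\<close>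

lemma kummer_endpoints:
  obtains a b c where "0 \<le> a" "a < b" "c < 0"
    "\<And>x. D x = \<gamma>\<^sup>2 * (x - c)\<^sup>2 * ((x - a) * (x - b))"
    "\<gamma> * c = - \<gamma> - \<beta> / sqrt ((a + 1) * (b + 1))"
    "\<alpha> \<noteq> 1 \<Longrightarrow> kummer_endpoints \<alpha> \<beta> \<gamma> = (a, b) \<and> 0 < a \<and> \<gamma> * c = - (\<bar>\<alpha> - 1\<bar> / sqrt (a * b))"
    "\<alpha> = 1 \<Longrightarrow> kummer_endpoint_one \<beta> \<gamma> = b \<and> a = 0"
proof -
  obtain a b c where ab: "0 \<le> a" "a < b" "c < 0"
    and D: "\<And>x. D x = \<gamma>\<^sup>2 * (x - c)\<^sup>2 * ((x - a) * (x - b))"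
    and e1: "\<gamma> * (2 * c + a + b) = 4 - 2 * (\<gamma> - \<alpha> + 1 + \<beta>)"
    and e2: "\<bar>\<alpha> - 1\<bar> = - \<gamma> * c * sqrt (a * b)"
    and e3: "\<beta> = - \<gamma> * (1 + c) * sqrt ((a + 1) * (b + 1))"
    by (rule D_factorization) blast
  have "\<beta> / sqrt ((a + 1) * (b + 1)) = - \<gamma> * (1 + c)"
    using e3 ab by (simp add: divide_eq_eq)
  then have gc: "\<gamma> * c = - \<gamma> - \<beta> / sqrt ((a + 1) * (b + 1))"
    by (simp add: algebra_simps)
  have sum: "\<gamma> * ((a + b) / 2) - \<alpha> + 1 + \<beta> - \<beta> / sqrt ((a + 1) * (b + 1)) = 2"
  proof -
    have "\<gamma> * ((a + b) / 2) = (\<gamma> * (2 * c + a + b) - 2 * (\<gamma> * c)) / 2" by (simp add: algebra_simps)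
    then show ?thesis unfolding e1 gc by argo
  qed
  show thesis
  proof (rule that[OF ab D gc])
    assume "\<alpha> \<noteq> 1"
    then have a: "0 < a" using e2 ab by (cases "a = 0") auto
    then have gc': "\<gamma> * c = - (\<bar>\<alpha> - 1\<bar> / sqrt (a * b))"
      using e2 ab by (simp add: field_simps)
    then have "is_kummer_endpoints \<alpha> \<beta> \<gamma> a b"
      using a ab gc sum unfolding is_kummer_endpoints_def by simp
    then show "kummer_endpoints \<alpha> \<beta> \<gamma> = (a, b) \<and> 0 < a \<and> \<gamma> * c = - (\<bar>\<alpha> - 1\<bar> / sqrt (a * b))"
      using kummer_endpoints_eq[OF gamma_pos \<open>\<alpha> \<noteq> 1\<close>] a gc' by blast
  next
    assume \<alpha>: "\<alpha> = 1"
    then have a: "a = 0" using e2 ab gamma_pos by simp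
    have "kummer_endpoint_one \<beta> \<gamma> = b"
      using kummer_endpoint_one_eq[OF gamma_pos, of \<beta> b] sum beta_or_alpha ab a \<alpha> by simp
    then show "kummer_endpoint_one \<beta> \<gamma> = b \<and> a = 0" using a by simp
  qed
qed

text \<open>On (a,b) the factor \<gamma> * (x - c) is positive since c < 0 \<le> a, so it comes out
  of the root; elsewhere D \<ge> 0 and the root vanishes.\<close>

lemma f_eq:
  assumes "0 \<le> a" "a < b" "c < 0"
    and D: "D x = \<gamma>\<^sup>2 * (x - c)\<^sup>2 * ((x - a) * (x - b))"
  shows "f x = 1 / (2 * pi) * sqrt ((x - a) * (b - x)) * (\<gamma> * (x - c) / (x * (x + 1))) * indicator {a<..<b} x"
proof (cases "x \<in> {a<..<b}")
  case True
  then have "- D x = (\<gamma> * (x - c))\<^sup>2 * ((x - a) * (b - x))" unfolding D by algebra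
  moreover have "0 \<le> (x - a) * (b - x)" "0 \<le> \<gamma> * (x - c)"
    using True assms gamma_pos by auto
  ultimately have "sqrt (max 0 (- D x)) = \<gamma> * (x - c) * sqrt ((x - a) * (b - x))"
    by (simp add: real_sqrt_mult)
  then show ?thesis using True assms(1) by (simp add: f_def field_simps)
next
  case False
  then have "0 \<le> (x - a) * (x - b)"
    using assms by (auto simp: zero_le_mult_iff not_less)
  then have "0 \<le> D x" unfolding D by (rule mult_nonneg_nonneg[rotated]) simp
  then show ?thesis using False by (auto simp: f_def max_def)
qed

lemma f_eq_kummer_density:
  assumes "\<alpha> \<noteq> 1"
  shows "f = kummer_density \<alpha> \<beta> \<gamma>"
proof
  fix x
  obtain a b c where ab: "0 \<le> a" "a < b" "c < 0"
    and D: "\<And>x. D x = \<gamma>\<^sup>2 * (x - c)\<^sup>2 * ((x - a) * (x - b))"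
    and gc: "\<gamma> * c = - \<gamma> - \<beta> / sqrt ((a + 1) * (b + 1))"
    and ep: "kummer_endpoints \<alpha> \<beta> \<gamma> = (a, b)"
    and "0 < a" and gc': "\<gamma> * c = - (\<bar>\<alpha> - 1\<bar> / sqrt (a * b))"
    using kummer_endpoints assms by metis
  \<comment> \<open>Partial fractions: \<gamma> * (x - c)/(x(x+1)) = s/x - t/(1+x).\<close>
  define s t where "s = \<bar>\<alpha> - 1\<bar> / sqrt (a * b)" and "t = \<beta> / sqrt ((a + 1) * (b + 1))"
  have "s = - \<gamma> * c" "t = - \<gamma> - \<gamma> * c" using gc gc' by (auto simp: s_def t_def)
  then have st: "\<gamma> * (x - c) = s * (1 + x) - t * x" by algebra
  show "f x = kummer_density \<alpha> \<beta> \<gamma> x"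
  proof (cases "x \<in> {a<..<b}")
    case True
    with \<open>0 < a\<close> have "0 < x" by simp
    then have "\<gamma> * (x - c) / (x * (x + 1)) = s / x - t / (1 + x)"
      unfolding st by (subst diff_frac_eq) (auto simp: add.commute)
    also have "s / x = \<bar>\<alpha> - 1\<bar> / (x * sqrt (a * b))"
      by (simp add: s_def mult.commute)
    also have "t / (1 + x) = \<beta> / ((1 + x) * sqrt ((a + 1) * (b + 1)))"
      by (simp add: t_def mult.commute)
    finally show ?thesis
      unfolding f_eq[OF ab D] kummer_density_def ep Let_def by (simp only: prod.case)
  next
    case False
    then show ?thesis
      unfolding f_eq[OF ab D] kummer_density_def ep by simp
  qed
qed

lemma f_eq_kummer_density_one:
  assumes "\<alpha> = 1"
  shows "f = kummer_density_one \<beta> \<gamma>"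
proof
  fix x
  obtain a b c where ab: "0 \<le> a" "a < b" "c < 0"
    and D: "\<And>x. D x = \<gamma>\<^sup>2 * (x - c)\<^sup>2 * ((x - a) * (x - b))"
    and gc: "\<gamma> * c = - \<gamma> - \<beta> / sqrt ((a + 1) * (b + 1))"
    and b: "kummer_endpoint_one \<beta> \<gamma> = b" and a: "a = 0"
    using kummer_endpoints assms by metis
  define t where "t = \<beta> / sqrt (b + 1)"
  have t: "t = - \<gamma> - \<gamma> * c" using gc a by (simp add: t_def)
  show "f x = kummer_density_one \<beta> \<gamma> x"
  proof (cases "x \<in> {0<..<b}")
    case True
    \<comment> \<open>The same partial fractions; here \<gamma> + t = -\<gamma> * c is the constant
      \<sigma> of the density.\<close>
    have "\<gamma> * (x - c) / (x * (x + 1)) = (\<gamma> + t) / x - t / (1 + x)"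
      using t True by (simp add: field_simps)
    also have "t / (1 + x) = \<beta> / ((1 + x) * sqrt (b + 1))"
      by (simp add: t_def mult.commute)
    finally show ?thesis
      unfolding f_eq[OF ab D] kummer_density_one_def b Let_def a t_def by (simp only: diff_zero)
  next
    case False
    then show ?thesis
      unfolding f_eq[OF ab D] kummer_density_one_def b Let_def a by simp
  qed
qed

theorem eq_free_kummer: "M = free_kummer \<alpha> \<beta> \<gamma>"
proof (cases "\<alpha> = 1")
  case False
  then show ?thesis
    using eq_atom_plus_density by (simp add: free_kummer_def prob_zero f_eq_kummer_density)
next
  case True
  \<comment> \<open>For \<alpha> = 1 one has \<beta> \<ge> 0 > 1 - (1 + sqrt \<gamma>)^2, which
    selects the second case of \<open>free_kummer\<close>.\<close>
  have "1 < 1 + sqrt \<gamma>" using gamma_pos by simp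
  then have "1 < (1 + sqrt \<gamma>)\<^sup>2" by (rule one_less_power) simp
  then have "\<not> \<beta> < 1 - (1 + sqrt \<gamma>)\<^sup>2" using True beta_or_alpha by auto
  then have "free_kummer \<alpha> \<beta> \<gamma> = density lborel (\<lambda>x. ennreal (kummer_density_one \<beta> \<gamma> x))"
    using True by (simp add: free_kummer_def)
  also have "\<dots> = density lborel f"
    by (simp only: f_eq_kummer_density_one[OF True])
  also have "\<dots> = atom_plus_density 0 f"
  proof (rule measure_eqI)
    show sets: "sets (density lborel f) = sets (atom_plus_density 0 f)"
      unfolding atom_plus_density_def by (simp add: sets.sigma_sets_eq[of borel, simplified])
  qed (simp add: emeasure_density emeasure_atom_plus_density)
  also have "\<dots> = M"
    using eq_atom_plus_density[symmetric] prob_zero True by simp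
  finally show ?thesis ..
qed

end

text \<open>The end points depend on \<alpha>, \<beta>, \<gamma> only, and so does \<gamma> * (1 -
  c); together they determine D(1), where \<delta> enters with coefficient -8.\<close>

lemma kummer_distribution_delta_unique:
  assumes "kummer_distribution M \<alpha> \<beta> \<gamma> \<delta>" "kummer_distribution M' \<alpha> \<beta> \<gamma> \<delta>'"
  shows "\<delta>' = \<delta>"
proof -
  have det: "\<exists>a b. kummer_disc \<alpha> \<beta> \<gamma> \<delta> (1::real) =
      (2 * \<gamma> + \<beta> / sqrt ((a + 1) * (b + 1)))\<^sup>2 * ((1 - a) * (1 - b)) \<and>
      (a, b) = (if \<alpha> = 1 then (0, kummer_endpoint_one \<beta> \<gamma>) else kummer_endpoints \<alpha> \<beta> \<gamma>)"
    if "kummer_distribution M \<alpha> \<beta> \<gamma> \<delta>" for M \<delta>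
  proof -
    interpret kummer_distribution M \<alpha> \<beta> \<gamma> \<delta> by fact
    obtain a b c where D: "\<And>x. D x = \<gamma>\<^sup>2 * (x - c)\<^sup>2 * ((x - a) * (x - b))"
      and gc: "\<gamma> * c = - \<gamma> - \<beta> / sqrt ((a + 1) * (b + 1))"
      and ep: "(a, b) = (if \<alpha> = 1 then (0, kummer_endpoint_one \<beta> \<gamma>) else kummer_endpoints \<alpha> \<beta> \<gamma>)"
      using kummer_endpoints by metis
    have "2 * \<gamma> + \<beta> / sqrt ((a + 1) * (b + 1)) = \<gamma> * (1 - c)"
      using gc by (simp add: algebra_simps)
    then show ?thesis using ep unfolding D
      by (intro exI[of _ a] exI[of _ b]) (simp add: power_mult_distrib)
  qed
  obtain a b where d: "kummer_disc \<alpha> \<beta> \<gamma> \<delta> (1::real) = (2 * \<gamma> + \<beta> / sqrt ((a + 1) * (b + 1)))\<^sup>2 * ((1 - a) * (1 - b))"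
    and ab: "(a, b) = (if \<alpha> = 1 then (0, kummer_endpoint_one \<beta> \<gamma>) else kummer_endpoints \<alpha> \<beta> \<gamma>)"
    using det[OF assms(1)] by blast
  obtain a' b' where d': "kummer_disc \<alpha> \<beta> \<gamma> \<delta>' (1::real) = (2 * \<gamma> + \<beta> / sqrt ((a' + 1) * (b' + 1)))\<^sup>2 * ((1 - a') * (1 - b'))"
    and ab': "(a', b') = (if \<alpha> = 1 then (0, kummer_endpoint_one \<beta> \<gamma>) else kummer_endpoints \<alpha> \<beta> \<gamma>)"
    using det[OF assms(2)] by blast
  have "a = a'" "b = b'" using ab ab' by (metis prod.inject)+
  then have "kummer_disc \<alpha> \<beta> \<gamma> \<delta> (1::real) = kummer_disc \<alpha> \<beta> \<gamma> \<delta>' 1"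
    using d d' by simp
  then show ?thesis by (simp add: kummer_disc_def kummer_lin_def)
qed

section \<open>Passage from the random variable to its distribution\<close>

lemma kummer_distributionI:
  assumes "is_distribution_of \<mu> \<phi> Z" "\<alpha> > 0" "\<gamma> > 0"
    "kummer_equation \<alpha> \<beta> \<gamma> \<delta> (cauchy_transform \<mu>)" "\<beta> \<ge> 0 \<or> \<alpha> > 1"
  shows "kummer_distribution \<mu> \<alpha> \<beta> \<gamma> \<delta>"
proof -
  have \<mu>: "prob_space \<mu>" and sets: "sets \<mu> = sets borel"
    using assms(1) by (auto simp: is_distribution_of_def)
  interpret real_distribution \<mu>
    using \<mu> sets by (simp add: real_distribution_def real_distribution_axioms_def)
  obtain K where K: "compact K" "K \<subseteq> {0..}" "prob K = 1"
    using assms(1) by (auto simp: is_distribution_of_def)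
  then have "AE t in \<mu>. t \<in> K"
    by (subst prob_eq_1[symmetric]) (auto intro: borel_closed compact_imp_closed)
  then have "AE t in \<mu>. 0 \<le> t"
    using K(2) by (auto elim!: eventually_mono)
  then show ?thesis
    using assms by unfold_locales auto
qed

text \<open>The second solution, against which \<delta> is compared, may live in another algebra;
  hence the second type variable \<open>'b\<close>.\<close>

theorem proposition5p5:
  fixes scaleC :: "complex \<Rightarrow> 'a::{real_normed_algebra_1, banach} \<Rightarrow> 'a"
    and star :: "'a \<Rightarrow> 'a"
    and \<phi> :: "'a \<Rightarrow> complex"
    and Z :: 'a
    and \<mu> :: "real measure"
    and \<alpha> \<beta> \<gamma> \<delta> :: real
  assumes "positive_random_variable scaleC star \<phi> Z"
    and "is_distribution_of \<mu> \<phi> Z"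
    and "\<alpha> > 0" and "\<gamma> > 0"
    and "kummer_equation \<alpha> \<beta> \<gamma> \<delta> (cauchy_transform \<mu>)"
    and "\<beta> \<ge> 0 \<or> \<alpha> > 1"
  shows "(\<forall>(scaleC' :: complex \<Rightarrow> 'b::{real_normed_algebra_1, banach} \<Rightarrow> 'b) star' \<phi>' Z' \<mu>' \<delta>'.
            positive_random_variable scaleC' star' \<phi>' Z' \<longrightarrow>
            is_distribution_of \<mu>' \<phi>' Z' \<longrightarrow>
            kummer_equation \<alpha> \<beta> \<gamma> \<delta>' (cauchy_transform \<mu>') \<longrightarrow>
            \<delta>' = \<delta>)
         \<and> \<mu> = free_kummer \<alpha> \<beta> \<gamma>"
proof (intro conjI allI impI)
  have K: "kummer_distribution \<mu> \<alpha> \<beta> \<gamma> \<delta>"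
    using assms by (intro kummer_distributionI)
  then show "\<mu> = free_kummer \<alpha> \<beta> \<gamma>"
    by (rule kummer_distribution.eq_free_kummer)
  fix \<phi>' :: "'b \<Rightarrow> complex" and Z' \<mu>' \<delta>'
  assume "is_distribution_of \<mu>' \<phi>' Z'" "kummer_equation \<alpha> \<beta> \<gamma> \<delta>' (cauchy_transform \<mu>')"
  then have "kummer_distribution \<mu>' \<alpha> \<beta> \<gamma> \<delta>'"
    using assms by (intro kummer_distributionI)
  with K show "\<delta>' = \<delta>"
    by (rule kummer_distribution_delta_unique)
qed

end
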